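(* Consider a binary supervised classification problem based on i.i.d. observations from a random pair $(X,Y)$, where $X$ takes values in the metric space $(\mathcal{E},\mathbb{H})$ of non-negative upper semicontinuous functions on $[0,1]$ with the hypograph Hausdorff metric, and $Y\in\{0,1\}$ indicates the class. Let $(g_n)$ be a sequence of $k$-NN classifiers (with respect to $\mathbb{H}$) with $k=k_n$ such that $k_n\to\infty$ and $k_n/n\to 0$ as $n\to\infty$. Whatever the distribution $Q$ of $(X,Y)$ (a Borel probability measure on $\mathcal{E}\times\{0,1\}$), there is another distribution $P$ on $\mathcal{E}\times\{0,1\}$, arbitrarily close to $Q$ in the weak topology (i.e. every neighbourhood of $Q$ in the topology of weak convergence of probability measures contains such a $P$), under which the regression function $\eta(x)=\mathbb{P}(Y=1\mid X=x)$ is continuous with compact support and the sequence $(g_n)$ is weakly consistent.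
   Context: $\mathcal{E}$ is the set of non-negative upper semicontinuous functions $f:[0,1]\to[0,\infty)$ (i.e. $\limsup_{x\to x_0}f(x)\le f(x_0)$ for all $x_0$). For $f\in\mathcal{E}$, the hypograph is $H_f=\{(x,y)\in\mathbb{R}^2: x\in[0,1],\ 0\le y\le f(x)\}$, a compact set, and $\mathbb{H}(f,g)=d_H(H_f,H_g)$, where $d_H(A,C)=\max\{\max_{a\in A}d(a,C),\max_{c\in C}d(c,A)\}$ is the Hausdorff distance between non-empty compact subsets of $\mathbb{R}^2$ (Euclidean distance). Training data: $D_n=((X_1,Y_1),\dots,(X_n,Y_n))$ are i.i.d. copies of $(X,Y)$, independent of $(X,Y)$. $k$-NN classifier: $g_n(x)\in\{0,1\}$ is the label held by the majority of the labels $Y_i$ among the $k$ observations $X_i$ of the training sample closest to $x$ in the metric $\mathbb{H}$; ties are broken at random. "The regression function is continuous with compact support" means that there is a continuous compactly supported function $\eta:\mathcal{E}\to[0,1]$ which is a version of the conditional probability $\mathbb{P}(Y=1\mid X=x)$. Weak consistency (under a given distribution of $(X,Y)$): the misclassification probability $L_n=\mathbb{P}(g_n(X)\ne Y\mid D_n)$ converges in probability, as $n\to\infty$, to the optimal value $L^*=\mathbb{P}(g^*(X)\neq Y)$, where $g^*(x)=\mathbb{I}_{\{\eta(x)>1/2\}}$ and $\eta(x)=\mathbb{P}(Y=1\mid X=x)$. *)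

theory Defs
  imports "HOL-Probability.Probability"
begin

section \<open>Upper semicontinuous functions and the hypograph metric\<close>

text \<open>Functions on \<open>[0,1]\<close> are represented by extensional functions, so that equality of
  elements of the type is equality on \<open>[0,1]\<close>.\<close>

typedef usc = "{f :: real \<Rightarrow> real. f \<in> {0..1} \<rightarrow>\<^sub>E {0..} \<and>
    (\<forall>x\<in>{0..1}. Limsup (at x within {0..1}) (\<lambda>t. ereal (f t)) \<le> ereal (f x))}"
  morphisms usc_fun Abs_usc
proof -
  have "Limsup (at x within {0..1}) (\<lambda>t. ereal (restrict (\<lambda>_. 0) {0..1} t))
      \<le> ereal (restrict (\<lambda>_. 0) {0..1} x)"
    if "x \<in> {0..1}" for x :: real
  proof (rule Limsup_bounded)
    show "\<forall>\<^sub>F t in at x within {0..1}.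
        ereal (restrict (\<lambda>_. 0) {0..1} t) \<le> ereal (restrict (\<lambda>_. 0) {0..1} x)"
      using that by (auto simp: eventually_at_filter)
  qed
  then have "restrict (\<lambda>_. 0) {0..1} \<in> {f :: real \<Rightarrow> real. f \<in> {0..1} \<rightarrow>\<^sub>E {0..} \<and>
    (\<forall>x\<in>{0..1}. Limsup (at x within {0..1}) (\<lambda>t. ereal (f t)) \<le> ereal (f x))}"
    by auto
  then show ?thesis by blast
qed

definition hypograph :: "usc \<Rightarrow> (real \<times> real) set" where
  "hypograph f = {(x, y). x \<in> {0..1} \<and> 0 \<le> y \<and> y \<le> usc_fun f x}"

text \<open>The suprema are attained for non-empty compact sets; the metric of \<open>real \<times> real\<close> is the
  Euclidean one.\<close>

definition hausdorff_dist :: "'a::metric_space set \<Rightarrow> 'a set \<Rightarrow> real" where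
  "hausdorff_dist A C = max (SUP a\<in>A. infdist a C) (SUP c\<in>C. infdist c A)"

lemma hausdorff_dist_commute: "hausdorff_dist A C = hausdorff_dist C A"
  by (simp add: hausdorff_dist_def max.commute)

lemma bdd_above_infdist:
  assumes "bounded A" "C \<noteq> {}"
  shows "bdd_above ((\<lambda>a. infdist a C) ` A)"
proof -
  obtain c where c: "c \<in> C" using assms by blast
  obtain e where e: "\<forall>a\<in>A. dist c a \<le> e"
    using assms(1) by (auto simp: bounded_any_center[where a = c])
  show ?thesis
    by (rule bdd_aboveI2[where M = e])
      (metis c dist_commute e infdist_le order_trans)
qed

lemma infdist_le_hausdorff_dist:
  assumes "bounded A" "C \<noteq> {}" "a \<in> A"
  shows "infdist a C \<le> hausdorff_dist A C"
proof -
  have "infdist a C \<le> (SUP a\<in>A. infdist a C)"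
    by (rule cSUP_upper[OF assms(3) bdd_above_infdist[OF assms(1,2)]])
  then show ?thesis by (simp add: hausdorff_dist_def)
qed

lemma hausdorff_dist_le:
  assumes "A \<noteq> {}" "C \<noteq> {}" "\<And>a. a \<in> A \<Longrightarrow> infdist a C \<le> e" "\<And>c. c \<in> C \<Longrightarrow> infdist c A \<le> e"
  shows "hausdorff_dist A C \<le> e"
  unfolding hausdorff_dist_def using assms by (auto intro!: cSUP_least)

lemma infdist_le_hausdorff_dist_add:
  assumes "bounded A" "bounded B" "B \<noteq> {}" "C \<noteq> {}" "a \<in> A"
  shows "infdist a C \<le> hausdorff_dist A B + hausdorff_dist B C"
proof -
  have "infdist a C - hausdorff_dist B C \<le> dist a b" if "b \<in> B" for b
    using infdist_triangle[of a C b] infdist_le_hausdorff_dist[OF assms(2,4) that] by simp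
  then have "infdist a C - hausdorff_dist B C \<le> infdist a B"
    using assms(3) by (auto simp: infdist_notempty intro!: cINF_greatest)
  then show ?thesis
    using infdist_le_hausdorff_dist[OF assms(1,3,5)] by simp
qed

lemma hausdorff_dist_triangle:
  assumes "bounded A" "bounded B" "bounded C" "A \<noteq> {}" "B \<noteq> {}" "C \<noteq> {}"
  shows "hausdorff_dist A C \<le> hausdorff_dist A B + hausdorff_dist B C"
proof (rule hausdorff_dist_le)
  show "infdist a C \<le> hausdorff_dist A B + hausdorff_dist B C" if "a \<in> A" for a
    by (rule infdist_le_hausdorff_dist_add) (use assms that in auto)
  have "infdist c A \<le> hausdorff_dist C B + hausdorff_dist B A" if "c \<in> C" for c
    by (rule infdist_le_hausdorff_dist_add) (use assms that in auto)
  then show "infdist c A \<le> hausdorff_dist A B + hausdorff_dist B C" if "c \<in> C" for c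
    using that by (metis add.commute hausdorff_dist_commute)
qed (use assms in auto)

lemma usc_fun_nonneg: "x \<in> {0..1} \<Longrightarrow> 0 \<le> usc_fun f x"
  using usc_fun[of f] by (auto simp: PiE_iff)

lemma usc_fun_less_nearby:
  assumes "x \<in> {0..1}" "usc_fun f x < c"
  obtains d where "d > 0" "\<And>t. t \<in> {0..1} \<Longrightarrow> dist t x < d \<Longrightarrow> usc_fun f t < c"
proof -
  have "Limsup (at x within {0..1}) (\<lambda>t. ereal (usc_fun f t)) \<le> ereal (usc_fun f x)"
    using usc_fun[of f] assms(1) by auto
  also have "\<dots> < ereal c" using assms(2) by simp
  finally have "\<forall>\<^sub>F t in at x within {0..1}. ereal (usc_fun f t) < ereal c"
    by (rule Limsup_lessD)
  then obtain d where "d > 0"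
    and d: "\<And>t. t \<in> {0..1} \<Longrightarrow> t \<noteq> x \<Longrightarrow> dist t x < d \<Longrightarrow> usc_fun f t < c"
    by (auto simp: eventually_at)
  show thesis
  proof (rule that[OF \<open>d > 0\<close>])
    show "usc_fun f t < c" if "t \<in> {0..1}" "dist t x < d" for t
      using d[OF that(1) _ that(2)] assms(2) by (cases "t = x") auto
  qed
qed

lemma hypograph_nonempty: "hypograph f \<noteq> {}"
  using usc_fun_nonneg[of 0 f] by (auto simp: hypograph_def intro!: exI[of _ 0])

lemma closed_hypograph: "closed (hypograph f)"
  unfolding closed_sequential_limits
proof safe
  fix z :: "nat \<Rightarrow> real \<times> real" and x y
  assume z: "\<forall>n. z n \<in> hypograph f" and lim: "z \<longlonglongrightarrow> (x, y)"
  have limx: "(\<lambda>n. fst (z n)) \<longlonglongrightarrow> x" and limy: "(\<lambda>n. snd (z n)) \<longlonglongrightarrow> y"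
    using tendsto_fst[OF lim] tendsto_snd[OF lim] by simp_all
  have zx: "fst (z n) \<in> {0..1}" and zy: "0 \<le> snd (z n)" "snd (z n) \<le> usc_fun f (fst (z n))" for n
    using z[rule_format, of n] by (auto simp: hypograph_def split: prod.splits)
  have x: "x \<in> {0..1}"
    by (rule closed_sequentially[OF closed_atLeastAtMost zx limx])
  have y: "0 \<le> y"
    by (rule LIMSEQ_le_const[OF limy]) (use zy in auto)
  have "y \<le> usc_fun f x"
  proof (rule ccontr)
    assume "\<not> y \<le> usc_fun f x"
    then obtain c where c: "usc_fun f x < c" "c < y" using dense[of "usc_fun f x" y] by auto
    obtain d where "d > 0" and d: "\<And>t. t \<in> {0..1} \<Longrightarrow> dist t x < d \<Longrightarrow> usc_fun f t < c"
      using usc_fun_less_nearby[OF x c(1)] by blast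
    have "\<forall>\<^sub>F n in sequentially. dist (fst (z n)) x < d"
      using limx \<open>d > 0\<close> by (auto simp: tendsto_iff)
    moreover have "\<forall>\<^sub>F n in sequentially. c < snd (z n)"
      using limy c(2) by (rule order_tendstoD)
    ultimately have "\<forall>\<^sub>F n in sequentially. False"
    proof eventually_elim
      case (elim n)
      show False using d[OF zx elim(1)] zy(2)[of n] elim(2) by linarith
    qed
    then show False by simp
  qed
  then show "(x, y) \<in> hypograph f" using x y by (simp add: hypograph_def)
qed

lemma usc_fun_bounded: "\<exists>B. \<forall>x\<in>{0..1}. usc_fun f x \<le> B"
proof (rule ccontr)
  assume "\<nexists>B. \<forall>x\<in>{0..1}. usc_fun f x \<le> B"
  then have "\<exists>x\<in>{0..1}. usc_fun f x > real n" for n by (meson not_le)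
  then obtain s where s: "\<And>n. s n \<in> {0..1}" "\<And>n. usc_fun f (s n) > real n" by metis
  obtain x r where x: "x \<in> {0..1}" and r: "strict_mono (r :: nat \<Rightarrow> nat)" and "(s \<circ> r) \<longlonglongrightarrow> x"
    using compact_Icc[of "0::real" 1] s(1) unfolding compact_def by metis
  obtain d where "d > 0" and d: "\<And>t. t \<in> {0..1} \<Longrightarrow> dist t x < d \<Longrightarrow> usc_fun f t < usc_fun f x + 1"
    using usc_fun_less_nearby[OF x, of f "usc_fun f x + 1"] by auto
  have "\<forall>\<^sub>F n in sequentially. dist (s (r n)) x < d"
    using \<open>(s \<circ> r) \<longlonglongrightarrow> x\<close> \<open>d > 0\<close> by (auto simp: tendsto_iff)
  moreover have "\<forall>\<^sub>F n in sequentially. usc_fun f x + 1 < real n"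
    by real_asymp
  ultimately have "\<forall>\<^sub>F n in sequentially. False"
  proof eventually_elim
    case (elim n)
    have "real n \<le> real (r n)" using seq_suble[OF r] by simp
    then show False using elim d[OF s(1), of "r n"] s(2)[of "r n"] by simp
  qed
  then show False by simp
qed

lemma bounded_hypograph: "bounded (hypograph f)"
proof -
  obtain B where B: "\<forall>x\<in>{0..1}. usc_fun f x \<le> B" using usc_fun_bounded by blast
  have "hypograph f \<subseteq> {0..1} \<times> {0..B}"
    using B by (force simp: hypograph_def)
  then show ?thesis by (rule bounded_subset[rotated]) (simp add: bounded_Times)
qed

lemma compact_hypograph: "compact (hypograph f)"
  by (simp add: compact_eq_bounded_closed bounded_hypograph closed_hypograph)

lemma hypograph_subset_imp_le:
  assumes "hypograph f \<subseteq> hypograph g" "x \<in> {0..1}"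
  shows "usc_fun f x \<le> usc_fun g x"
proof -
  have "(x, usc_fun f x) \<in> hypograph f"
    using assms(2) usc_fun_nonneg[OF assms(2)] by (simp add: hypograph_def)
  then show ?thesis using assms(1) by (auto simp: hypograph_def)
qed

lemma hypograph_inject: "hypograph f = hypograph g \<longleftrightarrow> f = g"
proof
  assume *: "hypograph f = hypograph g"
  have "usc_fun f = usc_fun g"
  proof (rule extensionalityI[of _ "{0..1}"])
    show "usc_fun f \<in> extensional {0..1}" "usc_fun g \<in> extensional {0..1}"
      using usc_fun[of f] usc_fun[of g] by (auto simp: PiE_iff)
    show "usc_fun f x = usc_fun g x" if "x \<in> {0..1}" for x
      by (rule antisym; rule hypograph_subset_imp_le) (use * that in auto)
  qed
  then show "f = g" by (simp add: usc_fun_inject)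
qed simp

instantiation usc :: metric_space
begin

definition dist_usc :: "usc \<Rightarrow> usc \<Rightarrow> real" where
  "dist_usc f g = hausdorff_dist (hypograph f) (hypograph g)"

definition uniformity_usc :: "(usc \<times> usc) filter" where
  "uniformity_usc = (INF e\<in>{0 <..}. principal {(f, g). dist f g < e})"

definition open_usc :: "usc set \<Rightarrow> bool" where
  "open_usc U = (\<forall>f\<in>U. \<forall>\<^sub>F (f', g) in uniformity. f' = f \<longrightarrow> g \<in> U)"

instance
proof
  fix f g h :: usc
  show "dist f g = 0 \<longleftrightarrow> f = g"
  proof
    assume *: "dist f g = 0"
    have sub: "hypograph p \<subseteq> hypograph q"
      if "hausdorff_dist (hypograph p) (hypograph q) = 0" for p q
    proof
      fix a assume "a \<in> hypograph p"
      then have "infdist a (hypograph q) = 0"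
        using infdist_le_hausdorff_dist[OF bounded_hypograph hypograph_nonempty, of a p q]
          infdist_nonneg[of a "hypograph q"] that by simp
      then show "a \<in> hypograph q"
        using in_closed_iff_infdist_zero[OF closed_hypograph hypograph_nonempty] by blast
    qed
    have "hypograph f = hypograph g"
      using sub[of f g] sub[of g f] * hausdorff_dist_commute[of "hypograph f" "hypograph g"]
      by (auto simp: dist_usc_def)
    then show "f = g" by (simp add: hypograph_inject)
  next
    assume "f = g"
    then show "dist f g = 0"
      by (simp add: dist_usc_def hausdorff_dist_def hypograph_nonempty cong: SUP_cong_simp)
  qed
  show "dist f g \<le> dist f h + dist g h"
    unfolding dist_usc_def hausdorff_dist_commute[of "hypograph g" "hypograph h"]
    by (intro hausdorff_dist_triangle bounded_hypograph hypograph_nonempty)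
qed (simp_all only: uniformity_usc_def open_usc_def)

end


section \<open>The topology of weak convergence\<close>

text \<open>The coarsest topology on the Borel probability measures making \<open>\<mu> \<mapsto> \<integral>f d\<mu>\<close> continuous for
  every bounded continuous real function \<open>f\<close>.\<close>

definition weak_topology :: "'a::topological_space measure topology" where
  "weak_topology = topology_generated_by
     {{\<mu>. prob_space \<mu> \<and> sets \<mu> = sets borel \<and> (\<integral>x. f x \<partial>\<mu>) \<in> U} | f U.
        continuous_on UNIV f \<and> bounded (range f) \<and> open (U :: real set)}"


section \<open>Nearest neighbour classification\<close>

text \<open>The label \<open>1\<close> is \<open>True\<close>. The defining equation says that \<open>\<eta> \<circ> fst\<close> is a version of the
  conditional probability of \<open>Y = 1\<close> given the \<open>\<sigma>\<close>-algebra generated by \<open>X\<close>.\<close>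

definition regression_function ::
    "('a::topological_space \<times> bool) measure \<Rightarrow> ('a \<Rightarrow> real) \<Rightarrow> bool" where
  "regression_function P \<eta> \<longleftrightarrow> \<eta> \<in> borel_measurable borel \<and>
     (AE z in P. real_cond_exp P (vimage_algebra (space P) fst borel) (indicator {(x, y). y}) z
        = \<eta> (fst z))"

definition bayes_classifier :: "('a \<Rightarrow> real) \<Rightarrow> 'a \<Rightarrow> bool" where
  "bayes_classifier \<eta> x \<longleftrightarrow> \<eta> x > 1/2"

definition bayes_error :: "('a \<times> bool) measure \<Rightarrow> ('a \<Rightarrow> real) \<Rightarrow> real" where
  "bayes_error P \<eta> = measure P {(x, y) \<in> space P. bayes_classifier \<eta> x \<noteq> y}"

text \<open>Randomised tie-breaking uses a seed \<open>(u, v)\<close>: observations at the same distance from the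
  query point are ordered by their priorities \<open>u\<close> (and by index on the null event that the
  priorities agree), and a tied vote is decided by the coin \<open>v\<close>.\<close>

type_synonym seed = "(nat \<Rightarrow> real) \<times> bool"

definition seed_measure :: "seed measure" where
  "seed_measure = (\<Pi>\<^sub>M i\<in>UNIV. uniform_measure lborel {0..1}) \<Otimes>\<^sub>M measure_pmf (bernoulli_pmf (1/2))"

definition nearer ::
    "(nat \<Rightarrow> 'a::metric_space \<times> bool) \<Rightarrow> (nat \<Rightarrow> real) \<Rightarrow> 'a \<Rightarrow> nat \<Rightarrow> nat \<Rightarrow> bool" where
  "nearer D u x i j \<longleftrightarrow>
     dist (fst (D i)) x < dist (fst (D j)) x \<or>
     dist (fst (D i)) x = dist (fst (D j)) x \<and> (u i < u j \<or> u i = u j \<and> i < j)"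

definition nearest_neighbours ::
    "nat \<Rightarrow> nat \<Rightarrow> (nat \<Rightarrow> 'a::metric_space \<times> bool) \<Rightarrow> (nat \<Rightarrow> real) \<Rightarrow> 'a \<Rightarrow> nat set" where
  "nearest_neighbours n k D u x = {i. i < n \<and> card {j. j < n \<and> nearer D u x j i} < k}"

definition knn_classifier ::
    "nat \<Rightarrow> nat \<Rightarrow> (nat \<Rightarrow> 'a::metric_space \<times> bool) \<Rightarrow> seed \<Rightarrow> 'a \<Rightarrow> bool" where
  "knn_classifier n k D s x =
     (let S = nearest_neighbours n k D (fst s) x;
          ones = card {i \<in> S. snd (D i)};
          zeros = card {i \<in> S. \<not> snd (D i)}
      in if ones > zeros then True else if ones < zeros then False else snd s)"

text \<open>Outcomes \<open>(D, (x, y), s)\<close> consist of an infinite i.i.d. sequence \<open>D\<close> of labelled observations,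
  whose first \<open>n\<close> members form the training sample \<open>D\<^sub>n\<close>, an independent test pair \<open>(x, y)\<close> and an
  independent seed \<open>s\<close>.\<close>

type_synonym 'a outcome = "(nat \<Rightarrow> 'a \<times> bool) \<times> ('a \<times> bool) \<times> seed"

definition sampling_measure :: "('a \<times> bool) measure \<Rightarrow> 'a outcome measure" where
  "sampling_measure P = (\<Pi>\<^sub>M i\<in>UNIV. P) \<Otimes>\<^sub>M (P \<Otimes>\<^sub>M seed_measure)"

definition training_algebra :: "('a \<times> bool) measure \<Rightarrow> nat \<Rightarrow> 'a outcome measure" where
  "training_algebra P n =
     vimage_algebra (space (sampling_measure P)) (\<lambda>\<omega>. restrict (fst \<omega>) {..<n}) (\<Pi>\<^sub>M i\<in>{..<n}. P)"

text \<open>A version of the conditional probability given \<open>D\<^sub>n\<close> that the \<open>n\<close>-th classifier errs on the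
  test pair.\<close>

definition misclassification_prob ::
    "('a \<times> bool) measure \<Rightarrow> (nat \<Rightarrow> (nat \<Rightarrow> 'a \<times> bool) \<Rightarrow> seed \<Rightarrow> 'a \<Rightarrow> bool)
      \<Rightarrow> nat \<Rightarrow> 'a outcome \<Rightarrow> real" where
  "misclassification_prob P g n =
     real_cond_exp (sampling_measure P) (training_algebra P n) (indicator {(D, (x, y), s). g n D s x \<noteq> y})"

definition tendsto_in_probability :: "'a measure \<Rightarrow> (nat \<Rightarrow> 'a \<Rightarrow> real) \<Rightarrow> real \<Rightarrow> bool" where
  "tendsto_in_probability M Z c \<longleftrightarrow>
     (\<forall>\<epsilon>>0. (\<lambda>n. measure M {\<omega> \<in> space M. \<bar>Z n \<omega> - c\<bar> > \<epsilon>}) \<longlonglongrightarrow> 0)"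

text \<open>\<open>\<eta>\<close> is meant to be a regression function of \<open>P\<close>; the value of \<open>bayes_error P \<eta>\<close> then
  does not depend on the version chosen.\<close>

definition weakly_consistent ::
    "('a \<times> bool) measure \<Rightarrow> ('a \<Rightarrow> real) \<Rightarrow> (nat \<Rightarrow> (nat \<Rightarrow> 'a \<times> bool) \<Rightarrow> seed \<Rightarrow> 'a \<Rightarrow> bool) \<Rightarrow> bool"
where
  "weakly_consistent P \<eta> g \<longleftrightarrow>
     tendsto_in_probability (sampling_measure P) (misclassification_prob P g) (bayes_error P \<eta>)"

end

theory Submission
  imports Defs
begin

text \<open>A weak neighbourhood of \<open>Q\<close> constrains only finitely many integrals, so it contains a measure
  \<open>P\<close> with finitely many atoms; as the hypograph space has no isolated points, the atoms can be
  perturbed so that each position carries a single label. Then \<open>Y\<close> is a function of \<open>X\<close> and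
  \<open>L\<^sup>* = 0\<close>. A \<open>{0, 1}\<close>-valued regression function on the atoms extends to a continuous function
  with compact support, because closed balls of the hypograph space are compact. Since
  \<open>k\<^sub>n / n \<rightarrow> 0\<close>, with probability tending to \<open>1\<close> at least \<open>k\<^sub>n\<close> observations coincide with the
  query point, so that all \<open>k\<^sub>n\<close> nearest neighbours carry the correct label.\<close>

section \<open>Compactness in the hypograph metric\<close>

text \<open>Closedness does double duty: every vertical section attains its supremum, so the graph
  of the function \<open>h\<close> of suprema lies in \<open>A\<close>; and limits of points of
  \<open>A\<close> stay in \<open>A\<close>, which is upper semicontinuity of \<open>h\<close>. With
  \<open>down\<close>, the region under \<open>h\<close> is then exactly \<open>A\<close>.\<close>

lemma usc_of_hypograph:
  fixes A :: "(real \<times> real) set"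
  assumes "closed A" and sub: "A \<subseteq> {0..1} \<times> {0..R}"
    and base: "\<And>x. x \<in> {0..1} \<Longrightarrow> (x, 0) \<in> A"
    and down: "\<And>x y y'. (x, y) \<in> A \<Longrightarrow> 0 \<le> y' \<Longrightarrow> y' \<le> y \<Longrightarrow> (x, y') \<in> A"
  obtains f where "hypograph f = A"
proof -
  define S where "S x = {y. (x, y) \<in> A}" for x
  define h where "h = (\<lambda>x\<in>{0..1}. Sup (S x))"
  have closed: "closed (S x)" for x
  proof -
    have "closed ((\<lambda>y. (x, y)) -` A)"
      by (intro closed_vimage \<open>closed A\<close> continuous_intros)
    then show ?thesis by (simp add: S_def vimage_def)
  qed
  have bdd: "bdd_above (S x)" for x
    using sub by (auto simp: S_def intro!: bdd_aboveI[of _ R])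
  have h_in: "(x, h x) \<in> A" if "x \<in> {0..1}" for x
    using closed_contains_Sup[OF _ bdd closed, of x] base[OF that] that by (auto simp: h_def S_def)
  have h_ge: "y \<le> h x" if "(x, y) \<in> A" for x y
    using cSup_upper[OF _ bdd, of y x] sub that by (auto simp: h_def S_def)
  have h_nonneg: "0 \<le> h x" if "x \<in> {0..1}" for x
    using h_ge[OF base[OF that]] .
  have "Limsup (at x within {0..1}) (\<lambda>t. ereal (h t)) \<le> ereal (h x)" if x: "x \<in> {0..1}" for x
  proof (rule ereal_le_epsilon2)
    fix e :: real assume "0 < e"
    \<comment> \<open>The point at height \<open>h x + e\<close> above \<open>x\<close> lies outside
      \<open>A\<close>, hence so do the points at this height above all nearby \<open>t\<close>. By
      \<open>down\<close>, no section over such a \<open>t\<close> can reach that height.\<close>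
    have "open (- ((\<lambda>t. (t, h x + e)) -` A))"
      by (intro open_Compl closed_vimage \<open>closed A\<close> continuous_intros)
    moreover have "x \<in> - ((\<lambda>t. (t, h x + e)) -` A)"
      using h_ge[of x "h x + e"] \<open>0 < e\<close> by auto
    ultimately have "\<forall>\<^sub>F t in at x within {0..1}. t \<in> - ((\<lambda>t. (t, h x + e)) -` A)"
      by (intro topological_tendstoD[OF tendsto_ident_at])
    moreover have "\<forall>\<^sub>F t in at x within {0..1}. t \<in> {0..1::real}"
      by (simp add: eventually_at_filter)
    ultimately have "\<forall>\<^sub>F t in at x within {0..1}. ereal (h t) \<le> ereal (h x) + ereal e"
    proof eventually_elim
      case (elim t)
      have "h t \<le> h x + e"
        using elim(1) down[OF h_in[OF elim(2)], of "h x + e"] h_nonneg[OF x] \<open>0 < e\<close>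
        by (cases "h t \<le> h x + e") auto
      then show ?case by simp
    qed
    then show "Limsup (at x within {0..1}) (\<lambda>t. ereal (h t)) \<le> ereal (h x) + ereal e"
      by (rule Limsup_bounded)
  qed
  moreover have "h \<in> {0..1} \<rightarrow>\<^sub>E {0..}"
    using h_nonneg by (auto simp: h_def)
  ultimately have rep: "usc_fun (Abs_usc h) = h"
    by (intro Abs_usc_inverse) blast
  have "hypograph (Abs_usc h) = A"
    unfolding hypograph_def rep
  proof safe
    show "(x, y) \<in> A" if "x \<in> {0..1}" "0 \<le> y" "y \<le> h x" for x y
      using down[OF h_in] that by blast
    show "x \<in> {0..1}" "0 \<le> y" "y \<le> h x" if "(x, y) \<in> A" for x y
      using sub h_ge that by auto
  qed
  then show thesis by (rule that)
qed

text \<open>A competitor \<open>(s, t)\<close> for the higher point can be cut off at height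
  \<open>y'\<close>: it stays in the hypograph, and its vertical gap to the lowered point is no
  larger than before.\<close>

lemma infdist_hypograph_mono:
  assumes "0 \<le> y'" "y' \<le> y"
  shows "infdist (x, y') (hypograph f) \<le> infdist (x, y) (hypograph f)"
proof -
  have "infdist (x, y') (hypograph f) \<le> dist (x, y) b" if "b \<in> hypograph f" for b
  proof -
    obtain s t where b: "b = (s, t)" by force
    have "(s, min t y') \<in> hypograph f"
      using that assms by (auto simp: b hypograph_def)
    moreover have "dist (x, y') (s, min t y') \<le> dist (x, y) (s, t)"
      unfolding dist_Pair_Pair dist_real_def using assms
      by (intro real_sqrt_le_mono add_left_mono power_mono) auto
    ultimately show ?thesis unfolding b by (rule infdist_le2)
  qed
  then show ?thesis
    using hypograph_nonempty by (auto simp: infdist_notempty[of _ "(x, y)"] intro!: cINF_greatest)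
qed

lemma infdist_hypograph_le_add_dist:
  "infdist a (hypograph f) \<le> infdist a (hypograph g) + dist f g"
proof -
  have "infdist a (hypograph f) - dist f g \<le> dist a b" if "b \<in> hypograph g" for b
    using infdist_triangle[of a "hypograph f" b]
      infdist_le_hausdorff_dist[OF bounded_hypograph hypograph_nonempty that, of f]
    by (simp add: dist_usc_def hausdorff_dist_commute)
  then have "infdist a (hypograph f) - dist f g \<le> infdist a (hypograph g)"
    using hypograph_nonempty by (auto simp: infdist_notempty[of "hypograph g"] intro!: cINF_greatest)
  then show ?thesis by simp
qed

lemma hypograph_approx:
  assumes "a \<in> hypograph f"
  obtains b where "b \<in> hypograph g" "dist a b \<le> dist f g"
proof -
  obtain b where "b \<in> hypograph g" "infdist a (hypograph g) = dist a b"
    by (rule infdist_attains_inf[OF closed_hypograph hypograph_nonempty])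
  then show thesis
    using that infdist_le_hausdorff_dist[OF bounded_hypograph hypograph_nonempty assms, of g]
    by (simp add: dist_usc_def)
qed

lemma dist_usc_le:
  assumes "\<And>a. a \<in> hypograph f \<Longrightarrow> infdist a (hypograph g) \<le> e"
    and "\<And>b. b \<in> hypograph g \<Longrightarrow> infdist b (hypograph f) \<le> e"
  shows "dist f g \<le> e"
  unfolding dist_usc_def using assms by (intro hausdorff_dist_le hypograph_nonempty) auto

section \<open>Completeness and total boundedness of uniformly bounded functions\<close>

definition usc_le :: "real \<Rightarrow> usc set" where
  "usc_le R = {f. hypograph f \<subseteq> {0..1} \<times> {0..R}}"

text \<open>The limit of a Cauchy sequence is read off from the hypographs: their limit set is
  closed, contains the base and is closed downwards, so it is again a hypograph. Compactness of the
  box supplies points of the limit set near every late hypograph.\<close>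

lemma complete_usc_le: "Topological_Spaces.complete (usc_le R)"
  unfolding complete_def
proof (intro allI impI, elim conjE)
  fix F :: "nat \<Rightarrow> usc" assume F: "\<forall>n. F n \<in> usc_le R" and cauchy: "Cauchy F"
  let ?H = "\<lambda>n. hypograph (F n)"
  let ?K = "{0..1} \<times> {0..R} :: (real \<times> real) set"
  have sub: "?H n \<subseteq> ?K" for n
    using F by (auto simp: usc_le_def)
  \<comment> \<open>The points approached by the whole sequence of hypographs, that is, its
    Kuratowski lower limit.\<close>
  define A where "A = {a \<in> ?K. (\<lambda>n. infdist a (?H n)) \<longlonglongrightarrow> 0}"
  have A_I: "a \<in> A" if "a \<in> ?K" and "\<And>e. e > 0 \<Longrightarrow> \<forall>\<^sub>F n in sequentially. infdist a (?H n) \<le> e" for a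
  proof -
    have "\<forall>\<^sub>F n in sequentially. dist (infdist a (?H n)) 0 < e" if "0 < e" for e
      using \<open>\<And>e. e > 0 \<Longrightarrow> \<forall>\<^sub>F n in sequentially. infdist a (?H n) \<le> e\<close>[of "e/2"] that
      by (auto elim!: eventually_mono simp: infdist_nonneg)
    then show ?thesis using that(1) by (auto simp: A_def tendsto_iff)
  qed
  have A_D: "\<forall>\<^sub>F n in sequentially. infdist a (?H n) < e" if "a \<in> A" "0 < e" for a e
    using that order_tendstoD(2)[of "\<lambda>n. infdist a (?H n)" 0 sequentially e] by (auto simp: A_def)
  have R: "0 \<le> R"
    using usc_fun_nonneg[of 0 "F 0"] sub[of 0] by (auto simp: hypograph_def)
  have "closed A"
    unfolding closed_sequential_limits
  proof (intro allI impI, elim conjE)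
    fix x l assume x: "\<forall>n. x n \<in> A" and lim: "x \<longlonglongrightarrow> l"
    have "closed ?K" by (intro closed_Times closed_atLeastAtMost)
    moreover have "x n \<in> ?K" for n using x unfolding A_def by blast
    ultimately have "l \<in> ?K" using lim by (rule closed_sequentially)
    then show "l \<in> A"
    proof (rule A_I)
      fix e :: real assume "e > 0"
      then obtain n where n: "dist (x n) l < e/2"
        using lim by (metis half_gt_zero lim_sequentially order_refl)
      have "\<forall>\<^sub>F m in sequentially. infdist (x n) (?H m) < e/2"
        using x \<open>e > 0\<close> by (intro A_D) auto
      then show "\<forall>\<^sub>F m in sequentially. infdist l (?H m) \<le> e"
      proof eventually_elim
        case (elim m)
        then show ?case using n infdist_triangle[of l "?H m" "x n"] by (simp add: dist_commute)
      qed
    qed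
  qed
  moreover have "A \<subseteq> {0..1} \<times> {0..R}" by (auto simp: A_def)
  moreover have "(x, 0) \<in> A" if "x \<in> {0..1}" for x
  proof -
    have "(x, 0) \<in> ?H n" for n
      using that usc_fun_nonneg[OF that] by (simp add: hypograph_def)
    then show ?thesis using that R by (simp add: A_def)
  qed
  moreover have "(x, y') \<in> A" if "(x, y) \<in> A" "0 \<le> y'" "y' \<le> y" for x y y'
  proof (rule A_I)
    show "(x, y') \<in> ?K" using that by (auto simp: A_def)
    show "\<forall>\<^sub>F n in sequentially. infdist (x, y') (?H n) \<le> e" if "e > 0" for e
      using A_D[OF \<open>(x, y) \<in> A\<close> that] infdist_hypograph_mono[OF \<open>0 \<le> y'\<close> \<open>y' \<le> y\<close>, of x]
      by (auto elim!: eventually_mono intro: less_imp_le order.strict_trans1)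
  qed
  ultimately obtain f where f: "hypograph f = A" by (rule usc_of_hypograph)
  have "F \<longlonglongrightarrow> f"
    unfolding tendsto_iff
  proof (intro allI impI)
    fix e :: real assume "e > 0"
    then obtain N where N: "\<And>m n. m \<ge> N \<Longrightarrow> n \<ge> N \<Longrightarrow> dist (F m) (F n) < e/2"
      using cauchy by (meson Cauchy_def half_gt_zero)
    have "dist (F n) f \<le> e/2" if n: "n \<ge> N" for n
    proof (rule dist_usc_le)
      fix a assume "a \<in> hypograph f"
      then have a: "a \<in> A" by (simp add: f)
      have "infdist a (?H n) \<le> d + e/2" if d: "d > 0" for d
      proof -
        \<comment> \<open>The detour goes through the index \<open>max M N\<close>, where
          \<open>a\<close> is already within \<open>d\<close> of the hypograph and the Cauchy bound
          applies as well.\<close>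
        obtain M where M: "\<And>m. m \<ge> M \<Longrightarrow> infdist a (?H m) < d"
          using A_D[OF a d] by (auto simp: eventually_sequentially)
        show ?thesis
          using M[of "max M N"] N[OF n, of "max M N"]
            infdist_hypograph_le_add_dist[of a "F n" "F (max M N)"] by simp
      qed
      then show "infdist a (?H n) \<le> e/2"
        by (metis add.commute field_le_epsilon)
    next
      fix a assume a: "a \<in> ?H n"
      \<comment> \<open>Points \<open>b m\<close> of the hypographs that stay near \<open>a\<close>
        accumulate at some \<open>l\<close> in the compact box; this \<open>l\<close> is the point
        of the limit set near \<open>a\<close>.\<close>
      have "\<exists>b. b \<in> ?H m \<and> dist a b \<le> dist (F n) (F m)" for m
        using hypograph_approx[OF a, of "F m"] by metis
      then obtain b where b: "\<And>m. b m \<in> ?H m" "\<And>m. dist a (b m) \<le> dist (F n) (F m)" by metis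
      have "compact ?K" by (intro compact_Times compact_Icc)
      moreover have "\<forall>m. b m \<in> ?K" using b(1) sub by blast
      ultimately obtain l r where l: "l \<in> ?K" and r: "strict_mono (r :: nat \<Rightarrow> nat)"
        and lim: "(b \<circ> r) \<longlonglongrightarrow> l"
        unfolding compact_def by metis
      have "l \<in> A"
      proof (rule A_I[OF l])
        fix d :: real assume "d > 0"
        then obtain M where M: "\<And>m n. m \<ge> M \<Longrightarrow> n \<ge> M \<Longrightarrow> dist (F m) (F n) < d/2"
          using cauchy by (meson Cauchy_def half_gt_zero)
        obtain M' where M': "\<And>m. m \<ge> M' \<Longrightarrow> dist (b (r m)) l < d/2"
          using lim \<open>d > 0\<close> unfolding lim_sequentially comp_def by (meson half_gt_zero)
        \<comment> \<open>Since \<open>p\<close> is beyond the Cauchy threshold \<open>M\<close> and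
          \<open>b p\<close> is close to \<open>l\<close>, the closeness of \<open>l\<close> to the
          single set \<open>?H p\<close> carries over to every \<open>?H m\<close> with
          \<open>m \<ge> M\<close>.\<close>
        define p where "p = r (max M M')"
        have p: "M \<le> p" "dist (b p) l < d/2"
          using seq_suble[OF r, of "max M M'"] M'[of "max M M'"] by (auto simp: p_def)
        have "infdist l (?H m) \<le> d" if "m \<ge> M" for m
        proof -
          have "infdist l (?H m) \<le> infdist l (?H p) + dist (F m) (F p)"
            by (rule infdist_hypograph_le_add_dist)
          moreover have "infdist l (?H p) \<le> dist l (b p)"
            by (intro infdist_le b)
          ultimately show ?thesis
            using M[OF that p(1)] p(2) by (simp add: dist_commute)
        qed
        then show "\<forall>\<^sub>F m in sequentially. infdist l (?H m) \<le> d"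
          by (auto simp: eventually_sequentially)
      qed
      moreover have "dist a l \<le> e/2"
      proof (rule LIMSEQ_le_const2)
        show "(\<lambda>m. dist a ((b \<circ> r) m)) \<longlonglongrightarrow> dist a l"
          by (intro tendsto_intros lim)
        have "dist a ((b \<circ> r) m) \<le> e/2" if "m \<ge> N" for m
          using b(2)[of "r m"] N[OF n, of "r m"] seq_suble[OF r, of m] that by simp
        then show "\<exists>N. \<forall>m\<ge>N. dist a ((b \<circ> r) m) \<le> e/2" by blast
      qed
      ultimately show "infdist a (hypograph f) \<le> e/2"
        unfolding f by (rule infdist_le2)
    qed
    then have "dist (F n) f < e" if "n \<ge> N" for n
      using \<open>e > 0\<close> that by (smt (verit) field_sum_of_halves)
    then show "\<forall>\<^sub>F n in sequentially. dist (F n) f < e"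
      by (auto simp: eventually_sequentially)
  qed
  moreover have "f \<in> usc_le R"
    by (auto simp: usc_le_def f A_def)
  ultimately show "\<exists>l\<in>usc_le R. F \<longlonglongrightarrow> l" by blast
qed

text \<open>Two hypographs that meet the same balls of a finite \<open>e/3\<close>-net of the box
  are within \<open>2 * e / 3\<close> of each other, and there are only finitely many such patterns.
  One representative per pattern forms the net.\<close>

lemma totally_bounded_usc_le:
  assumes "e > 0"
  shows "\<exists>C. finite C \<and> usc_le R \<subseteq> (\<Union>f\<in>C. ball f e)"
proof -
  let ?K = "{0..1} \<times> {0..R} :: (real \<times> real) set"
  have "compact ?K" by (intro compact_Times compact_Icc)
  then obtain G where G: "finite G" "?K \<subseteq> (\<Union>x\<in>G. ball x (e/3))"
    using assms unfolding compact_eq_totally_bounded by (meson divide_pos_pos zero_less_numeral)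
  define pat where "pat f = {c \<in> G. ball c (e/3) \<inter> hypograph f \<noteq> {}}" for f
  have near: "infdist a (hypograph g) \<le> 2 * e / 3"
    if f: "f \<in> usc_le R" and pat: "pat f = pat g" and a: "a \<in> hypograph f" for f g a
  proof -
    have "a \<in> ?K" using f a unfolding usc_le_def by blast
    then obtain c where c: "c \<in> G" "a \<in> ball c (e/3)"
      using G(2) by blast
    then have "c \<in> pat f" using a by (auto simp: pat_def)
    then obtain b where b: "b \<in> hypograph g" "b \<in> ball c (e/3)"
      unfolding pat by (auto simp: pat_def)
    show ?thesis
      using b c(2) dist_triangle[of a b c] by (intro infdist_le2[OF b(1)]) (auto simp: dist_commute)
  qed
  have "finite (pat ` usc_le R)"
    by (rule finite_subset[of _ "Pow G"]) (use G(1) in \<open>auto simp: pat_def\<close>)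
  then obtain C where C: "C \<subseteq> usc_le R" "finite C" "pat ` C = pat ` usc_le R"
    by (metis finite_subset_image order_refl)
  have "usc_le R \<subseteq> (\<Union>f\<in>C. ball f e)"
  proof
    fix f assume f: "f \<in> usc_le R"
    then obtain g where g: "g \<in> C" "pat g = pat f" using C(3) by (metis imageE imageI)
    have "dist g f \<le> 2 * e / 3"
      using near[of g f] near[of f g] g f C(1) by (intro dist_usc_le) auto
    then show "f \<in> (\<Union>f\<in>C. ball f e)" using g(1) assms by (auto intro!: bexI[of _ g])
  qed
  then show ?thesis using C(2) by blast
qed

section \<open>Closed balls, separability and absence of isolated points\<close>

lemma compact_usc_le: "compact (usc_le R)"
  using complete_usc_le totally_bounded_usc_le by (auto simp: compact_eq_totally_bounded)

text \<open>Every point of the hypograph of a \<open>g\<close> in the ball lies within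
  \<open>e\<close> of the bounded hypograph of \<open>f\<close>, which limits its height.\<close>

lemma cball_subset_usc_le: "\<exists>R. cball f e \<subseteq> usc_le R"
proof -
  obtain B where B: "\<And>b. b \<in> hypograph f \<Longrightarrow> norm b \<le> B"
    using bounded_hypograph[of f] unfolding bounded_iff by blast
  have "cball f e \<subseteq> usc_le (B + e)"
  proof
    fix g assume g: "g \<in> cball f e"
    have "(x, y) \<in> {0..1} \<times> {0..B + e}" if xy: "(x, y) \<in> hypograph g" for x y
    proof -
      obtain b where b: "b \<in> hypograph f" "dist (x, y) b \<le> dist g f"
        using hypograph_approx[OF xy] by metis
      then have "norm b \<le> B" "dist (x, y) b \<le> e"
        using B g by (auto simp: dist_commute)
      then have "norm (x, y) \<le> B + e"
        using norm_triangle_sub[of "(x, y)" b] by (simp add: dist_norm)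
      then have "y \<le> B + e"
        using norm_snd_le[of y x] by simp
      then show ?thesis using xy by (auto simp: hypograph_def)
    qed
    then show "g \<in> usc_le (B + e)" by (auto simp: usc_le_def)
  qed
  then show ?thesis by blast
qed

lemma compact_cball_usc: "compact (cball (f :: usc) e)"
proof -
  obtain R where "cball f e \<subseteq> usc_le R" using cball_subset_usc_le by blast
  then have "cball f e = usc_le R \<inter> cball f e" by blast
  then show ?thesis
    using compact_Int_closed[OF compact_usc_le closed_cball] by metis
qed

text \<open>Finite nets of \<open>usc_le n\<close> at the scales \<open>1/(m+1)\<close> centre a
  countable base. Second countability later identifies the Borel sets of a product with the product
  sigma-algebra and makes distances measurable.\<close>

instance usc :: second_countable_topology
proof
  have "\<exists>C. finite C \<and> usc_le R \<subseteq> (\<Union>f\<in>C. ball f (inverse (real (Suc m))))" for R m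
    by (intro totally_bounded_usc_le) simp
  then obtain C where C: "\<And>R m. finite (C R m)"
    "\<And>R m. usc_le R \<subseteq> (\<Union>f\<in>C R m. ball f (inverse (real (Suc m))))" by metis
  define B where "B = (\<Union>n m :: nat. (\<lambda>f. ball f (inverse (real (Suc m)))) ` C (real n) m)"
  have "countable B"
    unfolding B_def by (intro countable_UN countable_image) (auto simp: C(1) countable_finite)
  moreover have "topological_basis B"
  proof (rule topological_basisI)
    show "open U" if "U \<in> B" for U using that by (auto simp: B_def)
    fix U :: "usc set" and f assume "open U" "f \<in> U"
    then obtain e where e: "e > 0" "ball f e \<subseteq> U" by (meson openE)
    then obtain m where m: "inverse (real (Suc m)) < e / 2"
      using reals_Archimedean half_gt_zero by blast
    \<comment> \<open>The closed ball of radius 0 is \<open>{f}\<close>, so this places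
      \<open>f\<close> itself under a uniform bound.\<close>
    obtain R where "cball f 0 \<subseteq> usc_le R" using cball_subset_usc_le by blast
    moreover obtain n where "R \<le> real n" using real_arch_simple by blast
    ultimately have "f \<in> usc_le (real n)" by (force simp: usc_le_def)
    then obtain g where g: "g \<in> C (real n) m" "f \<in> ball g (inverse (real (Suc m)))"
      using C(2) by blast
    have "ball g (inverse (real (Suc m))) \<subseteq> ball f e"
    proof
      fix h assume "h \<in> ball g (inverse (real (Suc m)))"
      then show "h \<in> ball f e"
        using g(2) m dist_triangle[of f h g] by (simp add: dist_commute)
    qed
    moreover have "ball g (inverse (real (Suc m))) \<in> B"
      using g(1) unfolding B_def by blast
    ultimately show "\<exists>V\<in>B. f \<in> V \<and> V \<subseteq> U"
      using g(2) e(2) by blast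
  qed
  ultimately show "\<exists>B :: usc set set. countable B \<and> open = generate_topology B"
    using topological_basis_imp_subbasis by blast
qed

text \<open>Raising \<open>f\<close> by the constant \<open>e\<close> keeps upper semicontinuity and
  changes the function, while a point of the raised hypograph returns to the hypograph of
  \<open>f\<close> by a vertical move of length at most \<open>e\<close>.\<close>

lemma usc_shift:
  fixes f :: usc
  assumes "e > 0"
  obtains g where "g \<noteq> f" "dist f g \<le> e"
proof -
  let ?h = "\<lambda>x\<in>{0..1}. usc_fun f x + e"
  have "Limsup (at x within {0..1}) (\<lambda>t. ereal (?h t)) \<le> ereal (?h x)" if x: "x \<in> {0..1}" for x
  proof (rule ereal_le_epsilon2)
    fix d :: real assume "0 < d"
    then obtain r where r: "r > 0"
      and *: "\<And>t. t \<in> {0..1} \<Longrightarrow> dist t x < r \<Longrightarrow> usc_fun f t < usc_fun f x + d"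
      using usc_fun_less_nearby[OF x, of f "usc_fun f x + d"] by auto
    show "Limsup (at x within {0..1}) (\<lambda>t. ereal (?h t)) \<le> ereal (?h x) + ereal d"
    proof (rule Limsup_bounded)
      have "ereal (?h t) \<le> ereal (?h x) + ereal d" if "t \<in> {0..1}" "dist t x < r" for t
        using *[OF that] that(1) x by simp
      then show "\<forall>\<^sub>F t in at x within {0..1}. ereal (?h t) \<le> ereal (?h x) + ereal d"
        unfolding eventually_at using r by blast
    qed
  qed
  moreover have "?h \<in> {0..1} \<rightarrow>\<^sub>E {0..}"
    using usc_fun_nonneg[of _ f] assms by (auto intro!: add_nonneg_nonneg)
  ultimately have rep: "usc_fun (Abs_usc ?h) = ?h"
    by (intro Abs_usc_inverse) blast
  have "usc_fun (Abs_usc ?h) 0 \<noteq> usc_fun f 0"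
    unfolding rep using assms by simp
  then have "Abs_usc ?h \<noteq> f" by metis
  moreover have "dist f (Abs_usc ?h) \<le> e"
  proof (rule dist_usc_le)
    fix a assume "a \<in> hypograph f"
    then have "a \<in> hypograph (Abs_usc ?h)"
      unfolding hypograph_def rep using assms by auto
    then show "infdist a (hypograph (Abs_usc ?h)) \<le> e" using assms by simp
  next
    fix a assume "a \<in> hypograph (Abs_usc ?h)"
    then obtain x y where a: "a = (x, y)" "x \<in> {0..1}" "0 \<le> y" "y \<le> usc_fun f x + e"
      unfolding hypograph_def rep by auto
    have "(x, min y (usc_fun f x)) \<in> hypograph f"
      using a usc_fun_nonneg[of x f] by (simp add: hypograph_def)
    moreover have "dist a (x, min y (usc_fun f x)) \<le> e"
      using a assms by (auto simp: dist_Pair_Pair dist_real_def)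
    ultimately show "infdist a (hypograph f) \<le> e" by (rule infdist_le2)
  qed
  ultimately show thesis by (rule that)
qed

instance usc :: perfect_space
proof
  fix f :: usc
  show "\<not> open {f}"
  proof
    assume "open {f}"
    then obtain e where e: "e > 0" "ball f e \<subseteq> {f}" by (meson openE singletonI)
    then obtain g where "g \<noteq> f" "dist f g \<le> e/2" using usc_shift[of "e/2" f] by auto
    then show False using e by (auto simp: subset_iff)
  qed
qed

section \<open>Approximation by atomic measures\<close>

text \<open>A bounded sequence lies in a closed ball, which is compact. This property later turns a
  bounded support into a compact one.\<close>

instance usc :: heine_borel
proof
  fix f :: "nat \<Rightarrow> usc" assume "bounded (range f)"
  then obtain a e where "\<forall>n. f n \<in> cball a e"
    unfolding bounded_def by auto
  then show "\<exists>l r. strict_mono r \<and> (f \<circ> r) \<longlonglongrightarrow> l"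
    using compact_cball_usc[of a e] unfolding compact_def by meson
qed

section \<open>Weak neighbourhoods and finite quantization\<close>

definition weak_box ::
    "('a::topological_space \<Rightarrow> real) set \<Rightarrow> real \<Rightarrow> 'a measure \<Rightarrow> 'a measure set" where
  "weak_box F e Q =
     {P. prob_space P \<and> sets P = sets borel \<and> (\<forall>f\<in>F. \<bar>(\<integral>x. f x \<partial>P) - (\<integral>x. f x \<partial>Q)\<bar> < e)}"

lemma weak_box_Un: "weak_box (F \<union> F') (min e e') Q \<subseteq> weak_box F e Q \<inter> weak_box F' e' Q"
  by (auto simp: weak_box_def)

text \<open>Induction over the generation of the topology: an intersection pools the test functions
  and takes the smaller tolerance, a union uses one member containing \<open>Q\<close>, and a
  subbasic set contains a box with its single test function.\<close>

lemma weak_topology_nhd_contains_weak_box: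
  fixes N :: "'a::topological_space measure set"
  assumes "openin weak_topology N" "Q \<in> N"
  shows "\<exists>F e. finite F \<and> e > 0 \<and> (\<forall>f\<in>F. continuous_on UNIV f \<and> bounded (range f)) \<and>
    weak_box F e Q \<subseteq> N"
proof -
  define S where "S =
     {{\<mu> :: 'a measure. prob_space \<mu> \<and> sets \<mu> = sets borel \<and> (\<integral>x. f x \<partial>\<mu>) \<in> U} | f U.
        continuous_on UNIV f \<and> bounded (range f) \<and> open (U :: real set)}"
  have "generate_topology_on S N"
    using assms(1) unfolding weak_topology_def S_def by (rule openin_topology_generated_by)
  then show ?thesis
    using assms(2)
  proof (induction rule: generate_topology_on.induct)
    case Empty
    then show ?case by simp
  next
    case (Int a b)
    obtain F e where F: "finite F" "e > 0" "\<forall>f\<in>F. continuous_on UNIV f \<and> bounded (range f)"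
      "weak_box F e Q \<subseteq> a"
      using Int by blast
    obtain F' e' where F': "finite F'" "e' > 0" "\<forall>f\<in>F'. continuous_on UNIV f \<and> bounded (range f)"
      "weak_box F' e' Q \<subseteq> b"
      using Int by blast
    have "weak_box (F \<union> F') (min e e') Q \<subseteq> a \<inter> b"
      using weak_box_Un F(4) F'(4) by blast
    then show ?case
      using F(1-3) F'(1-3) by (intro exI[of _ "F \<union> F'"] exI[of _ "min e e'"]) auto
  next
    case (UN K)
    then obtain k where k: "k \<in> K" "Q \<in> k" by blast
    with UN.IH obtain F e where "finite F" "e > 0" "\<forall>f\<in>F. continuous_on UNIV f \<and> bounded (range f)"
      "weak_box F e Q \<subseteq> k"
      by blast
    then show ?case using k(1) by (intro exI[of _ F] exI[of _ e]) blast
  next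
    case (Basis s)
    then obtain f U where s: "s = {\<mu>. prob_space \<mu> \<and> sets \<mu> = sets borel \<and> (\<integral>x. f x \<partial>\<mu>) \<in> U}"
      and f: "continuous_on UNIV f" "bounded (range f)" and U: "open (U :: real set)"
      unfolding S_def by blast
    then obtain e where e: "e > 0" "ball (\<integral>x. f x \<partial>Q) e \<subseteq> U"
      using Basis.prems by (auto elim: openE)
    have "weak_box {f} e Q \<subseteq> s"
      using e(2) by (auto simp: s weak_box_def subset_iff dist_real_def abs_minus_commute)
    then show ?case
      using f e(1) by (intro exI[of _ "{f}"] exI[of _ e]) auto
  qed
qed

text \<open>Greedy choice: the finitely many values already taken cannot exhaust the next infinite
  set.\<close>

lemma inj_choice_infinite:
  assumes "finite I" "\<And>i. i \<in> I \<Longrightarrow> infinite (S i)"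
  obtains x where "inj_on x I" "\<And>i. i \<in> I \<Longrightarrow> x i \<in> S i"
proof -
  have "\<exists>x. inj_on x I \<and> (\<forall>i\<in>I. x i \<in> S i)"
    using assms
  proof (induction I)
    case (insert i I)
    then obtain x where x: "inj_on x I" "\<forall>j\<in>I. x j \<in> S j" by auto
    have "infinite (S i - x ` I)"
      using insert by (intro Diff_infinite_finite) auto
    then obtain a where a: "a \<in> S i" "a \<notin> x ` I"
      by (metis Diff_iff finite.emptyI subsetI subset_antisym ex_in_conv)
    have "inj_on (x(i := a)) (insert i I)"
      using x(1) a(2) insert.hyps(2) by (auto simp: inj_on_def)
    moreover have "\<forall>j\<in>insert i I. (x(i := a)) j \<in> S j"
      using x(2) a(1) by auto
    ultimately show ?case by blast
  qed simp
  then show thesis using that by blast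
qed

lemma infinite_open_perfect:
  fixes U :: "'a::{metric_space, perfect_space} set"
  assumes "open U" "x \<in> U"
  shows "infinite U"
proof -
  obtain e where "e > 0" "ball x e \<subseteq> U" using assms by (meson openE)
  then show ?thesis
    using islimpt_UNIV[of x] unfolding islimpt_eq_infinite_ball
    by (metis Int_UNIV_left finite_subset)
qed

text \<open>Since there are no isolated points, the representatives of the finitely many cells on which
  all \<open>f \<in> F\<close> are nearly constant can be moved to have distinct first components.\<close>

lemma finite_quantization:
  fixes F :: "('a::{metric_space, perfect_space} \<times> bool \<Rightarrow> real) set"
  assumes "finite F" and cont: "\<And>f. f \<in> F \<Longrightarrow> continuous_on UNIV f"
    and bdd: "\<And>f. f \<in> F \<Longrightarrow> bounded (range f)" and "e > 0"
  obtains T where "T \<in> borel \<rightarrow>\<^sub>M borel" "finite (range T)" "inj_on fst (range T)"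
    "\<And>f z. f \<in> F \<Longrightarrow> \<bar>f (T z) - f z\<bar> < e"
proof -
  \<comment> \<open>One half of the error pays for replacing a point by the representative of its
    cell, the other for moving that representative.\<close>
  define d where "d = e / 2"
  have d: "d > 0" using assms by (simp add: d_def)
  \<comment> \<open>The cell of \<open>z\<close> is coded by the grid indices of all values
    \<open>f z\<close>. Restriction to \<open>F\<close> makes the codes extensional, so bounded test
    functions leave only finitely many of them.\<close>
  define c where "c z = (\<lambda>f\<in>F. \<lfloor>f z / d\<rfloor>)" for z :: "'a \<times> bool"
  have c_eq: "\<bar>f z - f w\<bar> < d" if "c z = c w" "f \<in> F" for z w f
  proof -
    have "\<lfloor>f z / d\<rfloor> = \<lfloor>f w / d\<rfloor>"
      using fun_cong[OF that(1), of f] that(2) by (simp add: c_def)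
    then have "\<bar>f z / d - f w / d\<bar> < 1" by linarith
    then show ?thesis using d by (simp add: flip: diff_divide_distrib)
  qed
  have "\<exists>B. \<forall>z. \<bar>f z\<bar> \<le> B" if "f \<in> F" for f
    using bdd[OF that] by (auto simp: bounded_iff)
  then obtain B where B: "\<And>f z. f \<in> F \<Longrightarrow> \<bar>f z\<bar> \<le> B f" by metis
  have "range c \<subseteq> (\<Pi>\<^sub>E f\<in>F. {\<lfloor>- B f / d\<rfloor>..\<lfloor>B f / d\<rfloor>})"
  proof -
    have "\<lfloor>- B f / d\<rfloor> \<le> \<lfloor>f z / d\<rfloor> \<and> \<lfloor>f z / d\<rfloor> \<le> \<lfloor>B f / d\<rfloor>" if "f \<in> F" for f z
      using B[OF that, of z] d by (intro conjI floor_mono divide_right_mono) auto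
    then show ?thesis by (auto simp: c_def)
  qed
  then have fin: "finite (range c)"
    by (rule finite_subset) (intro finite_PiE assms finite_atLeastAtMost_int)
  obtain r where r: "\<And>v. v \<in> range c \<Longrightarrow> c (r v) = v" by (metis f_inv_into_f)
  \<comment> \<open>The admissible first components for the representative of cell \<open>v\<close>,
    with its label kept fixed. This set is open and contains \<open>fst (r v)\<close>, hence is
    infinite.\<close>
  define S where "S v = {x. \<forall>f\<in>F. \<bar>f (x, snd (r v)) - f (r v)\<bar> < d}" for v
  have "infinite (S v)" for v
  proof (rule infinite_open_perfect)
    have "S v = (\<Inter>f\<in>F. {x. \<bar>f (x, snd (r v)) - f (r v)\<bar> < d})"
      by (auto simp: S_def)
    also have "open \<dots>"
    proof (intro open_INT assms ballI)
      fix f assume "f \<in> F"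
      have "continuous_on UNIV (\<lambda>x. f (x, snd (r v)))"
        by (rule continuous_on_compose2[OF cont[OF \<open>f \<in> F\<close>]]) (auto intro!: continuous_intros)
      then show "open {x. \<bar>f (x, snd (r v)) - f (r v)\<bar> < d}"
        by (intro open_Collect_less continuous_intros)
    qed
    finally show "open (S v)" .
    show "fst (r v) \<in> S v" using d by (simp add: S_def)
  qed
  then obtain x where x: "inj_on x (range c)" "\<And>v. v \<in> range c \<Longrightarrow> x v \<in> S v"
    using inj_choice_infinite[OF fin, of S] by blast
  define t where "t v = (x v, snd (r v))" for v
  define T where "T z = t (c z)" for z
  have range: "range T = t ` range c" by (auto simp: T_def)
  have "T -` A \<inter> space borel \<in> sets borel" if "A \<in> sets borel" for A
  proof -
    have "T -` A = (\<Union>v\<in>{v \<in> range c. t v \<in> A}. {z. c z = v})"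
      by (auto simp: T_def)
    also have "\<dots> \<in> sets borel"
    proof (intro sets.finite_UN)
      fix v assume "v \<in> {v \<in> range c. t v \<in> A}"
      \<comment> \<open>Both codes being extensional, their equality reduces to finitely many
        measurable conditions, one for each \<open>f \<in> F\<close>.\<close>
      then have "v \<in> extensional F" by (auto simp: c_def)
      then have "{z. c z = v} = {z \<in> space borel. \<forall>f\<in>F. \<lfloor>f z / d\<rfloor> = v f}"
        by (auto simp: c_def fun_eq_iff extensional_def restrict_def)
      also have "\<dots> \<in> sets borel"
      proof (intro sets.sets_Collect_finite_All assms)
        fix f assume "f \<in> F"
        then have [measurable]: "f \<in> borel_measurable borel"
          using cont by (intro borel_measurable_continuous_onI) auto
        show "{z \<in> space borel. \<lfloor>f z / d\<rfloor> = v f} \<in> sets borel" by measurable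
      qed
      finally show "{z. c z = v} \<in> sets borel" .
    qed (use fin in auto)
    finally show ?thesis by simp
  qed
  then have "T \<in> borel \<rightarrow>\<^sub>M borel" by (intro measurableI) auto
  moreover have "finite (range T)" unfolding range using fin by simp
  moreover have "inj_on fst (range T)"
  proof (rule inj_onI)
    fix z w assume zw: "z \<in> range T" "w \<in> range T" "fst z = fst w"
    obtain v where v: "v \<in> range c" "z = t v" using zw(1) unfolding range by blast
    obtain v' where v': "v' \<in> range c" "w = t v'" using zw(2) unfolding range by blast
    have "x v = x v'" using zw(3) v(2) v'(2) by (simp add: t_def)
    then show "z = w" using inj_onD[OF x(1) _ v(1) v'(1)] v(2) v'(2) by simp
  qed
  moreover have "\<bar>f (T z) - f z\<bar> < e" if "f \<in> F" for f z
  proof -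
    have "\<bar>f (T z) - f (r (c z))\<bar> < d"
      using x(2)[of "c z"] that by (simp add: S_def T_def t_def)
    moreover have "\<bar>f (r (c z)) - f z\<bar> < d"
      using c_eq[of "r (c z)" z f] r[of "c z"] that by simp
    ultimately show ?thesis unfolding d_def by linarith
  qed
  ultimately show thesis by (rule that)
qed

text \<open>\<open>P\<close> is the image of \<open>Q\<close> under a quantization that changes each
  test function by less than \<open>e / 2\<close> pointwise, hence its integral by less than
  \<open>e\<close>. Discarding the values of mass 0 from the finite range leaves
  \<open>Z\<close>.\<close>

lemma weak_nhd_contains_atomic:
  fixes Q :: "('a::{metric_space, perfect_space} \<times> bool) measure"
  assumes "openin weak_topology N" "Q \<in> N" "prob_space Q" "sets Q = sets borel"
  obtains P Z where "P \<in> N" "prob_space P" "sets P = sets borel" "finite Z" "inj_on fst Z"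
    "AE z in P. z \<in> Z" "\<And>z. z \<in> Z \<Longrightarrow> measure P {z} > 0"
proof -
  interpret Q: prob_space Q by fact
  obtain F e where F: "finite F" "e > 0" "\<forall>f\<in>F. continuous_on UNIV f \<and> bounded (range f)"
    and N: "weak_box F e Q \<subseteq> N"
    using weak_topology_nhd_contains_weak_box[OF assms(1,2)] by blast
  obtain T where T: "T \<in> borel \<rightarrow>\<^sub>M borel" "finite (range T)" "inj_on fst (range T)"
    "\<And>f z. f \<in> F \<Longrightarrow> \<bar>f (T z) - f z\<bar> < e / 2"
    by (rule finite_quantization[of F "e / 2"]) (use F in auto)
  have T_meas [measurable]: "T \<in> Q \<rightarrow>\<^sub>M borel"
    using T(1) measurable_cong_sets[OF assms(4) refl] by blast
  define P where "P = distr Q borel T"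
  interpret P: prob_space P unfolding P_def by (intro Q.prob_space_distr T_meas)
  have sets_P: "sets P = sets borel" by (simp add: P_def)
  have "P \<in> weak_box F e Q"
    unfolding weak_box_def mem_Collect_eq
  proof (intro conjI ballI)
    fix f assume f: "f \<in> F"
    have [measurable]: "f \<in> borel_measurable borel"
      using F(3) f by (intro borel_measurable_continuous_onI) auto
    then have [measurable]: "f \<in> borel_measurable Q"
      using measurable_cong_sets[OF assms(4) refl] by blast
    have "\<exists>B. \<forall>z. \<bar>f z\<bar> \<le> B" using F(3) f by (auto simp: bounded_iff dest!: bspec)
    then obtain B where B: "\<And>z. \<bar>f z\<bar> \<le> B" by blast
    have int: "integrable Q f" "integrable Q (\<lambda>z. f (T z))"
      by (auto intro!: Q.integrable_const_bound[of _ B] simp: B)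
    have "\<bar>(\<integral>z. f z \<partial>P) - (\<integral>z. f z \<partial>Q)\<bar> = \<bar>\<integral>z. f (T z) - f z \<partial>Q\<bar>"
      using int by (simp add: P_def integral_distr)
    also have "\<dots> \<le> (\<integral>z. \<bar>f (T z) - f z\<bar> \<partial>Q)" by (rule integral_abs_bound)
    also have "\<dots> \<le> (\<integral>z. e / 2 \<partial>Q)"
      using int T(4)[OF f] by (intro integral_mono) (auto intro: less_imp_le)
    also have "\<dots> < e" using F(2) by (simp add: Q.prob_space)
    finally show "\<bar>(\<integral>z. f z \<partial>P) - (\<integral>z. f z \<partial>Q)\<bar> < e" .
  qed (rule P.prob_space_axioms, rule sets_P)
  then have "P \<in> N" using N by blast
  define Z where "Z = {z \<in> range T. measure P {z} > 0}"
  have "AE z in P. z \<in> range T"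
    unfolding P_def by (subst AE_distr_iff) (auto intro!: borel_closed finite_imp_closed T(2))
  moreover have "AE z in P. \<forall>w\<in>range T - Z. z \<noteq> w"
  proof (rule AE_finite_allI)
    show "AE z in P. z \<noteq> w" if "w \<in> range T - Z" for w
    proof (rule AE_I)
      show "{z \<in> space P. \<not> z \<noteq> w} \<subseteq> {w}" by auto
      show "emeasure P {w} = 0"
        using that by (auto simp: Z_def P.emeasure_eq_measure zero_less_measure_iff)
      show "{w} \<in> sets P" by (simp add: sets_P)
    qed
  qed (use T(2) in auto)
  ultimately have "AE z in P. z \<in> Z" by eventually_elim auto
  moreover have "Z \<subseteq> range T" and pos: "\<And>z. z \<in> Z \<Longrightarrow> measure P {z} > 0"
    by (auto simp: Z_def)
  moreover from this have "finite Z" "inj_on fst Z"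
    using T(2,3) by (auto intro: finite_subset inj_on_subset)
  ultimately show thesis
    using \<open>P \<in> N\<close> P.prob_space_axioms sets_P by (intro that[of P Z] pos)
qed

text \<open>A tent over \<open>A\<close>: it decreases linearly with the distance from
  \<open>A\<close> and vanishes from distance \<open>d\<close> on, where \<open>d\<close> does not
  exceed the distance of any point of \<open>B\<close>.\<close>

lemma finite_separating_function:
  fixes A B :: "'a::heine_borel set"
  assumes "finite A" "finite B" "A \<inter> B = {}"
  obtains h :: "'a \<Rightarrow> real" where "continuous_on UNIV h" "range h \<subseteq> {0..1}"
    "compact (closure {x. h x \<noteq> 0})" "\<And>x. x \<in> A \<Longrightarrow> h x = 1" "\<And>x. x \<in> B \<Longrightarrow> h x = 0"
proof (cases "A = {}")
  case True
  \<comment> \<open>The distance to the empty set is 0 by convention, so the tent would be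
    constantly 1; the zero function serves instead.\<close>
  then show thesis by (intro that[of "\<lambda>_. 0"]) auto
next
  case False
  \<comment> \<open>The inserted 1 keeps the minimum meaningful when \<open>B\<close> is
    empty.\<close>
  define d where "d = Min (insert 1 ((\<lambda>b. infdist b A) ` B))"
  have "closed A" using assms(1) by (rule finite_imp_closed)
  then have pos: "0 < infdist b A" if "b \<in> B" for b
    using infdist_pos_not_in_closed[OF _ False] assms(3) that by blast
  have d: "0 < d" unfolding d_def using assms(2) pos by (subst Min_gr_iff) auto
  define h where "h x = max 0 (1 - infdist x A / d)" for x
  have zero: "h x = 0 \<longleftrightarrow> d \<le> infdist x A" for x
    using d by (auto simp: h_def max_def field_simps)
  show thesis
  proof (rule that[of h])
    show "continuous_on UNIV h" unfolding h_def using d by (intro continuous_intros) auto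
    show "range h \<subseteq> {0..1}" using d by (auto simp: h_def infdist_nonneg)
    \<comment> \<open>The support lies in a closed neighbourhood of the finite set \<open>A\<close>,
      which is compact by the Heine-Borel property.\<close>
    have "{x. h x \<noteq> 0} \<subseteq> {x. infdist x A \<le> d}" by (auto simp: zero)
    moreover have "compact {x. infdist x A \<le> d}"
      using d False assms(1) by (intro compact_infdist_le finite_imp_compact)
    ultimately show "compact (closure {x. h x \<noteq> 0})"
      by (metis bounded_subset closure_minimal compact_closure compact_imp_bounded)
    show "h x = 1" if "x \<in> A" for x using that by (simp add: h_def)
    show "h x = 0" if "x \<in> B" for x unfolding zero d_def using that assms(2) by (intro Min_le) auto
  qed
qed

section \<open>Nearest neighbours under atomic measures\<close>

text \<open>Almost surely the label indicator equals \<open>h\<close> of the position. That function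
  is measurable with respect to the sigma-algebra generated by the position, so it is its own
  conditional expectation.\<close>

lemma regression_function_atomic:
  fixes P :: "('a::topological_space \<times> bool) measure"
  assumes "prob_space P" "sets P = sets borel" "AE z in P. z \<in> Z"
    and h [measurable]: "h \<in> borel_measurable borel"
    and "\<And>x y. (x, y) \<in> Z \<Longrightarrow> h x = of_bool y"
  shows "regression_function P h"
proof -
  interpret prob_space P by fact
  let ?F = "vimage_algebra (space P) fst (borel :: 'a measure)"
  let ?I = "indicator {(x, y). y} :: 'a \<times> bool \<Rightarrow> real"
  have space: "space P = UNIV" using sets_eq_imp_space_eq[OF assms(2)] by simp
  have fst_borel: "fst \<in> (borel :: ('a \<times> bool) measure) \<rightarrow>\<^sub>M borel"
    by (intro borel_measurable_continuous_onI continuous_intros)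
  then have fst [measurable]: "fst \<in> P \<rightarrow>\<^sub>M borel"
    using measurable_cong_sets[OF assms(2) refl] by blast
  have "subalgebra P ?F"
    using sets_image_in_sets[OF refl fst] by (simp add: subalgebra_def)
  then interpret finite_measure_subalgebra P ?F by unfold_locales
  have "open {(x :: 'a, y). y}"
  proof -
    have "{(x :: 'a, y). y} = UNIV \<times> {True}" by auto
    then show ?thesis by (simp add: open_Times Topological_Spaces.open_discrete)
  qed
  then have I: "{(x :: 'a, y). y} \<in> sets P"
    unfolding assms(2) by (rule borel_open)
  have "AE z in P. ?I z = h (fst z)"
    using assms(3) by eventually_elim (auto simp: assms(5) indicator_def)
  then have "AE z in P. real_cond_exp P ?F ?I z = real_cond_exp P ?F (\<lambda>z. h (fst z)) z"
    using I by (intro real_cond_exp_cong) auto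
  moreover have "AE z in P. real_cond_exp P ?F (\<lambda>z. h (fst z)) z = h (fst z)"
  proof (rule real_cond_exp_F_meas)
    show "(\<lambda>z. h (fst z)) \<in> borel_measurable ?F"
      by (rule measurable_compose[OF measurable_vimage_algebra1 h]) simp
    \<comment> \<open>The values of \<open>h\<close> are known only on \<open>Z\<close>, so the
      bound that gives integrability is an almost sure one.\<close>
    have "AE z in P. norm (h (fst z)) \<le> 1"
      using assms(3) by eventually_elim (auto simp: assms(5))
    then show "integrable P (\<lambda>z. h (fst z))"
      by (rule integrable_const_bound) measurable
  qed
  ultimately have "AE z in P. real_cond_exp P ?F ?I z = h (fst z)"
    by eventually_elim simp
  then show ?thesis using h by (simp add: regression_function_def)
qed

lemma bayes_error_atomic:
  assumes "AE z in P. z \<in> Z" "\<And>x y. (x, y) \<in> Z \<Longrightarrow> h x = of_bool y"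
  shows "bayes_error P h = 0"
proof -
  have "AE z in P. z \<notin> {(x, y) \<in> space P. bayes_classifier h x \<noteq> y}"
    using assms(1) by eventually_elim (auto simp: bayes_classifier_def assms(2))
  \<comment> \<open>Either the error event is measurable and thus null, or its measure is 0 by
    convention.\<close>
  then have "emeasure P {(x, y) \<in> space P. bayes_classifier h x \<noteq> y} = 0"
    using AE_iff_null_sets emeasure_notin_sets null_setsD1 by blast
  then show ?thesis
    by (simp add: bayes_error_def measure_def)
qed

text \<open>With \<open>k\<close> observations at distance \<open>0\<close>, all \<open>k\<close> nearest neighbours coincide with the query
  point, and their labels are determined by their position.\<close>

lemma knn_classifier_atomic:
  assumes "inj_on fst Z" "\<And>i. i < n \<Longrightarrow> D i \<in> Z" "z \<in> Z" "0 < k"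
    and card: "k \<le> card {i. i < n \<and> D i = z}"
  shows "knn_classifier n k D s (fst z) = snd z"
proof -
  define S where "S = nearest_neighbours n k D (fst s) (fst z)"
  let ?R = "nearer D (fst s) (fst z)"
  have "finite S"
    by (rule finite_subset[of _ "{..<n}"]) (auto simp: S_def nearest_neighbours_def)
  have eq: "D i = z" if "i \<in> S" for i
  proof (rule ccontr)
    assume "D i \<noteq> z"
    have "i < n" "card {j. j < n \<and> ?R j i} < k"
      using that by (auto simp: S_def nearest_neighbours_def)
    have "fst (D i) \<noteq> fst z"
      using inj_onD[OF assms(1) _ assms(2)[OF \<open>i < n\<close>] assms(3)] \<open>D i \<noteq> z\<close> by blast
    \<comment> \<open>An observation at another position is preceded by every observation equal to
      \<open>z\<close>, and there are at least \<open>k\<close> of those.\<close>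
    then have "{j. j < n \<and> D j = z} \<subseteq> {j. j < n \<and> ?R j i}"
      by (auto simp: nearer_def)
    then have "card {j. j < n \<and> D j = z} \<le> card {j. j < n \<and> ?R j i}"
      by (intro card_mono) auto
    then show False using card \<open>card {j. j < n \<and> ?R j i} < k\<close> by simp
  qed
  \<comment> \<open>It remains to exclude an empty vote, which the coin would decide: the
    observation that is minimal for \<open>nearer\<close> has no predecessor and is selected because
    \<open>0 < k\<close>.\<close>
  have "n \<noteq> 0" using card \<open>0 < k\<close> by (cases n) auto
  then have "{..<n} \<noteq> {}" by auto
  moreover have "asymp_on {..<n} ?R"
    by (rule asymp_onI) (auto simp: nearer_def)
  moreover have "transp_on {..<n} ?R"
    by (rule transp_onI) (auto simp: nearer_def)
  ultimately obtain m where m: "m < n" "\<forall>j\<in>{..<n}. j \<noteq> m \<longrightarrow> \<not> ?R j m"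
    using Finite_Set.bex_min_element[of "{..<n}" ?R] by blast
  moreover have "\<not> ?R m m" by (simp add: nearer_def)
  ultimately have "{j. j < n \<and> ?R j m} = {}" by (metis (mono_tags, lifting) empty_Collect_eq lessThan_iff)
  then have "card {j. j < n \<and> ?R j m} < k" using \<open>0 < k\<close> by (simp only: card.empty)
  then have "m \<in> S"
    unfolding S_def nearest_neighbours_def using m(1) by blast
  then have pos: "card S > 0" using \<open>finite S\<close> card_gt_0_iff by blast
  \<comment> \<open>The vote is unanimous, so neither a majority count nor the coin matters beyond
    \<open>S\<close> being nonempty.\<close>
  have "{i \<in> S. snd (D i)} = (if snd z then S else {})"
    "{i \<in> S. \<not> snd (D i)} = (if snd z then {} else S)"
    using eq by auto
  then show ?thesis
    using pos unfolding knn_classifier_def S_def[symmetric] by (simp add: Let_def)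
qed

section \<open>The number of visits to an atom\<close>

lemma card_lt_set_measurable:
  assumes "{z} \<in> sets P"
  shows "{D \<in> space (\<Pi>\<^sub>M i\<in>UNIV. P). card {i. i < n \<and> D i = z} < (k :: nat)}
    \<in> sets (\<Pi>\<^sub>M i\<in>(UNIV :: nat set). P)"
proof -
  have [measurable]: "{D \<in> space (\<Pi>\<^sub>M i\<in>UNIV. P). D i = z} \<in> sets (\<Pi>\<^sub>M i\<in>(UNIV :: nat set). P)" for i
  proof -
    have "(\<lambda>D. D i) -` {z} \<inter> space (\<Pi>\<^sub>M i\<in>UNIV. P) \<in> sets (\<Pi>\<^sub>M i\<in>(UNIV :: nat set). P)"
      using assms by (intro measurable_sets[OF measurable_component_singleton]) auto
    then show ?thesis by (simp add: vimage_def Int_def conj_commute)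
  qed
  have [measurable]: "(\<lambda>D. card {i. i < n \<and> D i = z})
    \<in> (\<Pi>\<^sub>M i\<in>(UNIV :: nat set). P) \<rightarrow>\<^sub>M count_space UNIV"
    by (rule measurable_card) (simp, measurable)
  show ?thesis by measurable
qed

text \<open>Hoeffding's inequality for the indicators of visits to \<open>z\<close>: with
  \<open>p\<close> the mass of \<open>z\<close>, fewer than \<open>k\<close> visits means falling at
  least \<open>n * p / 2\<close> below the mean \<open>n * p\<close>. The bound is written as an
  \<open>n\<close>-th power so that its limit is geometric.\<close>

lemma prob_few_visits_le:
  assumes "prob_space P" "{z} \<in> sets P" and "n > 0" and k: "real k \<le> real n * measure P {z} / 2"
  shows "measure (\<Pi>\<^sub>M i\<in>UNIV. P) {D \<in> space (\<Pi>\<^sub>M i\<in>UNIV. P). card {i. i < n \<and> D i = z} < k}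
    \<le> exp (- (measure P {z})\<^sup>2 / 2) ^ n"
proof -
  define p where "p = measure P {z}"
  let ?M = "\<Pi>\<^sub>M i\<in>(UNIV :: nat set). P"
  interpret P: prob_space P by fact
  interpret PP: product_prob_space "\<lambda>_. P" "UNIV :: nat set" by unfold_locales
  define X where "X i D = (indicator {z} (D i) :: real)" for i :: nat and D :: "nat \<Rightarrow> 'a"
  have [measurable]: "(indicator {z} :: 'a \<Rightarrow> real) \<in> borel_measurable P"
    using assms(2) by simp
  have indep: "PP.indep_vars (\<lambda>_. P) (\<lambda>i D. D i) {..<n}"
  proof (subst PP.indep_vars_iff_distr_eq_PiM')
    show "distr ?M (\<Pi>\<^sub>M i\<in>{..<n}. P) (\<lambda>D. \<lambda>i\<in>{..<n}. D i) = (\<Pi>\<^sub>M i\<in>{..<n}. distr ?M P (\<lambda>D. D i))"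
      using PP.distr_PiM_restrict_finite[of "{..<n}"] PP.PiM_component by simp
  qed (use \<open>n > 0\<close> in auto)
  have "PP.indep_vars (\<lambda>_. borel) X {..<n}"
    using PP.indep_vars_compose2[OF indep, of "\<lambda>_. indicator {z} :: 'a \<Rightarrow> real" "\<lambda>_. borel"]
    unfolding X_def by simp
  then interpret H: Hoeffding_ineq ?M "{..<n}" X "\<lambda>_. 0" "\<lambda>_. 1" "\<Sum>i<n. PP.expectation (X i)"
    by unfold_locales (auto simp: X_def indicator_def)
  have expect: "PP.expectation (X i) = p" for i
  proof -
    have "PP.expectation (X i) = (\<integral>x. indicator {z} x \<partial>distr ?M P (\<lambda>D. D i))"
      unfolding X_def by (subst integral_distr) simp_all
    also have "\<dots> = p"
      using assms(2) by (simp add: PP.PiM_component p_def)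
    finally show ?thesis .
  qed
  have sum: "(\<Sum>i<n. X i D) = real (card {i. i < n \<and> D i = z})" for D
    by (simp add: X_def indicator_def sum.If_cases Int_def flip: of_bool_def)
  have [measurable]: "X i \<in> borel_measurable ?M" for i
    unfolding X_def by measurable
  have "PP.prob {D \<in> space ?M. card {i. i < n \<and> D i = z} < k}
    \<le> PP.prob {D \<in> space ?M. (\<Sum>i<n. X i D) \<le> (\<Sum>i<n. PP.expectation (X i)) - real n * p / 2}"
  proof (rule PP.finite_measure_mono)
    have "real (card {i. i < n \<and> D i = z}) \<le> real n * p - real n * p / 2"
      if "card {i. i < n \<and> D i = z} < k" for D
      using k that unfolding p_def[symmetric] by linarith
    then show "{D \<in> space ?M. card {i. i < n \<and> D i = z} < k}
      \<subseteq> {D \<in> space ?M. (\<Sum>i<n. X i D) \<le> (\<Sum>i<n. PP.expectation (X i)) - real n * p / 2}"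
      unfolding sum expect by auto
    show "{D \<in> space ?M. (\<Sum>i<n. X i D) \<le> (\<Sum>i<n. PP.expectation (X i)) - real n * p / 2} \<in> PP.events"
      by measurable
  qed
  also have "\<dots> \<le> exp (- 2 * (real n * p / 2)\<^sup>2 / (\<Sum>i<n. (1 - 0)\<^sup>2))"
    using \<open>n > 0\<close> by (intro H.Hoeffding_ineq_le) (auto simp: p_def)
  also have "\<dots> = exp (real n * (- p\<^sup>2 / 2))"
    using \<open>n > 0\<close> by (simp add: power2_eq_square field_simps)
  also have "\<dots> = exp (- p\<^sup>2 / 2) ^ n" by (rule exp_of_nat_mult)
  finally show ?thesis by (simp add: p_def)
qed

lemma prob_few_visits_tendsto_0:
  assumes "prob_space P" "{z} \<in> sets P" "measure P {z} > 0"
    and k: "(\<lambda>n. real (k n) / real n) \<longlonglongrightarrow> 0"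
  shows "(\<lambda>n. measure (\<Pi>\<^sub>M i\<in>UNIV. P)
    {D \<in> space (\<Pi>\<^sub>M i\<in>UNIV. P). card {i. i < n \<and> D i = z} < k n}) \<longlonglongrightarrow> 0"
proof (rule tendsto_sandwich[OF _ _ tendsto_const])
  show "(\<lambda>n. exp (- (measure P {z})\<^sup>2 / 2) ^ n) \<longlonglongrightarrow> 0"
    using assms(3) by (intro LIMSEQ_realpow_zero) auto
  have "\<forall>\<^sub>F n in sequentially. real (k n) / real n < measure P {z} / 2"
    using assms(3) by (intro order_tendstoD(2)[OF k]) auto
  then show "\<forall>\<^sub>F n in sequentially. measure (\<Pi>\<^sub>M i\<in>UNIV. P)
      {D \<in> space (\<Pi>\<^sub>M i\<in>UNIV. P). card {i. i < n \<and> D i = z} < k n}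
    \<le> exp (- (measure P {z})\<^sup>2 / 2) ^ n"
    \<comment> \<open>Positive \<open>n\<close> is needed to clear the denominator in
      \<open>k n / n\<close>.\<close>
    using eventually_gt_at_top[of 0]
    by eventually_elim (intro prob_few_visits_le assms, auto simp: field_simps)
qed simp

section \<open>Measurability of the error event, and consistency\<close>

lemma prob_space_seed_measure: "prob_space seed_measure"
proof -
  have "prob_space (uniform_measure lborel {0..1::real})"
    by (rule prob_space_uniform_measure) simp_all
  then show ?thesis
    unfolding seed_measure_def
    by (intro prob_space_pair prob_space_PiM prob_space_measure_pmf)
qed

lemma sets_seed_measure:
  "sets seed_measure = sets ((\<Pi>\<^sub>M i\<in>UNIV. borel) \<Otimes>\<^sub>M count_space UNIV)"
proof -
  have "sets (\<Pi>\<^sub>M i\<in>(UNIV :: nat set). uniform_measure lborel {0..1 :: real}) = sets (\<Pi>\<^sub>M i\<in>UNIV. borel)"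
    by (rule sets_PiM_cong) simp_all
  then show ?thesis
    unfolding seed_measure_def by (rule sets_pair_measure_cong) simp
qed

text \<open>Makes the Borel sets of labelled points the product of the Borel sets of positions and
  the discrete sigma-algebra of labels.\<close>

instance bool :: second_countable_topology
proof
  have "(open :: bool set \<Rightarrow> bool) = generate_topology UNIV"
    by (rule ext) (simp add: Topological_Spaces.open_discrete generate_topology.Basis)
  then show "\<exists>B :: bool set set. countable B \<and> open = generate_topology B"
    by (intro exI[of _ UNIV]) (simp add: countable_finite)
qed

text \<open>The sigma-algebra of the sampling measure is that of a product of Borel and discrete
  spaces. There the event is a finite combination of comparisons of distances and priorities, counts
  of such comparisons, labels and the coin.\<close>

lemma knn_error_measurable:
  fixes P :: "('a::{metric_space, second_countable_topology} \<times> bool) measure"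
  assumes "sets P = sets borel"
  shows "{\<omega> \<in> space (sampling_measure P). case \<omega> of (D, (x, y), s) \<Rightarrow> knn_classifier n k D s x \<noteq> y}
    \<in> sets (sampling_measure P)"
proof -
  let ?B = "(\<Pi>\<^sub>M i\<in>(UNIV :: nat set). (borel :: 'a measure) \<Otimes>\<^sub>M (count_space UNIV :: bool measure)) \<Otimes>\<^sub>M
    (((borel :: 'a measure) \<Otimes>\<^sub>M (count_space UNIV :: bool measure)) \<Otimes>\<^sub>M
     ((\<Pi>\<^sub>M i\<in>(UNIV :: nat set). (borel :: real measure)) \<Otimes>\<^sub>M (count_space UNIV :: bool measure)))"
  have "sets P = sets ((borel :: 'a measure) \<Otimes>\<^sub>M (count_space UNIV :: bool measure))"
    unfolding assms borel_prod[symmetric] by (intro sets_pair_measure_cong) (auto simp: sets_borel_eq_count_space)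
  then have sets: "sets (sampling_measure P) = sets ?B"
    unfolding sampling_measure_def
    by (intro sets_pair_measure_cong sets_PiM_cong sets_seed_measure) auto
  define near where "near \<omega> i j \<longleftrightarrow> nearer (fst \<omega>) (fst (snd (snd \<omega>))) (fst (fst (snd \<omega>))) i j"
    for i j and \<omega> :: "'a outcome"
  have [measurable]: "(\<lambda>\<omega>. fst \<omega> i) \<in> ?B \<rightarrow>\<^sub>M (borel \<Otimes>\<^sub>M count_space UNIV)" for i
    by (rule measurable_compose[OF measurable_fst measurable_component_singleton]) simp
  have [measurable]: "(\<lambda>\<omega>. fst (snd (snd \<omega>)) i) \<in> ?B \<rightarrow>\<^sub>M borel" for i
  proof -
    have "(\<lambda>\<omega>. fst (snd (snd \<omega>))) \<in> ?B \<rightarrow>\<^sub>M (\<Pi>\<^sub>M i\<in>UNIV. borel)" by measurable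
    then show ?thesis by (rule measurable_compose[OF _ measurable_component_singleton]) simp
  qed
  have [measurable]: "Measurable.pred ?B (\<lambda>\<omega>. near \<omega> i j)" for i j
    unfolding near_def nearer_def by measurable
  have [measurable]: "Measurable.pred ?B (\<lambda>\<omega>. card {j. j < n \<and> near \<omega> j i} < k)" for i
    by measurable
  define ones where "ones \<omega> = card {i. (i < n \<and> card {j. j < n \<and> near \<omega> j i} < k) \<and> snd (fst \<omega> i)}" for \<omega>
  define zeros where "zeros \<omega> = card {i. (i < n \<and> card {j. j < n \<and> near \<omega> j i} < k) \<and> \<not> snd (fst \<omega> i)}" for \<omega>
  have [measurable]: "ones \<in> ?B \<rightarrow>\<^sub>M count_space UNIV" "zeros \<in> ?B \<rightarrow>\<^sub>M count_space UNIV"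
    unfolding ones_def zeros_def by measurable
  have [measurable]: "Measurable.pred ?B (\<lambda>\<omega>. snd (snd (snd \<omega>)))"
    "Measurable.pred ?B (\<lambda>\<omega>. snd (fst (snd \<omega>)))"
    by measurable
  \<comment> \<open>The left side of the equivalence is the verdict of the classifier in terms of
    the two counts and the coin; an error means that it equals the negated test label.\<close>
  have "{\<omega> \<in> space ?B. (zeros \<omega> < ones \<omega> \<or> zeros \<omega> = ones \<omega> \<and> snd (snd (snd \<omega>)))
      \<longleftrightarrow> \<not> snd (fst (snd \<omega>))} \<in> sets ?B"
    by measurable
  also have "{\<omega> \<in> space ?B. (zeros \<omega> < ones \<omega> \<or> zeros \<omega> = ones \<omega> \<and> snd (snd (snd \<omega>)))
      \<longleftrightarrow> \<not> snd (fst (snd \<omega>))}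
    = {\<omega> \<in> space ?B. case \<omega> of (D, (x, y), s) \<Rightarrow> knn_classifier n k D s x \<noteq> y}"
  proof (rule Collect_cong)
    fix \<omega> :: "'a outcome"
    obtain D x y s where \<omega>: "\<omega> = (D, (x, y), s)" by (metis prod.exhaust)
    show "\<omega> \<in> space ?B \<and> ((zeros \<omega> < ones \<omega> \<or> zeros \<omega> = ones \<omega> \<and> snd (snd (snd \<omega>)))
        \<longleftrightarrow> \<not> snd (fst (snd \<omega>))) \<longleftrightarrow>
      \<omega> \<in> space ?B \<and> (case \<omega> of (D, (x, y), s) \<Rightarrow> knn_classifier n k D s x \<noteq> y)"
      unfolding \<omega> knn_classifier_def nearest_neighbours_def ones_def zeros_def near_def Let_def
      by auto
  qed
  finally show ?thesis
    unfolding sets sets_eq_imp_space_eq[OF sets] .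
qed

text \<open>Almost surely, an error forces the atom hit by the test point to have fewer than
  \<open>k n\<close> visits in the sample. A union bound over the finitely many atoms sends the
  error probability to 0, and Markov's inequality passes this on to the conditional error
  probability.\<close>

lemma weakly_consistent_atomic:
  fixes P :: "('a::{metric_space, second_countable_topology} \<times> bool) measure"
  assumes "prob_space P" "sets P = sets borel" "finite Z" "inj_on fst Z" "AE z in P. z \<in> Z"
    and pos: "\<And>z. z \<in> Z \<Longrightarrow> measure P {z} > 0"
    and h: "\<And>x y. (x, y) \<in> Z \<Longrightarrow> h x = of_bool y"
    and k: "filterlim k at_top sequentially" "(\<lambda>n. real (k n) / real n) \<longlonglongrightarrow> 0"
  shows "weakly_consistent P h (\<lambda>n. knn_classifier n (k n))"
proof -
  let ?D = "\<Pi>\<^sub>M i\<in>(UNIV :: nat set). P"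
  let ?M = "sampling_measure P"
  interpret P: prob_space P by fact
  interpret D: product_prob_space "\<lambda>_. P" "UNIV :: nat set" by unfold_locales
  interpret T: prob_space "P \<Otimes>\<^sub>M seed_measure"
    by (intro prob_space_pair prob_space_seed_measure) fact
  interpret S: prob_space seed_measure by (rule prob_space_seed_measure)
  interpret M: prob_space ?M
    unfolding sampling_measure_def
    by (intro prob_space_pair T.prob_space_axioms D.prob_space_axioms)
  have space: "space ?M = UNIV"
    using sets_eq_imp_space_eq[OF assms(2)] sets_eq_imp_space_eq[OF sets_seed_measure]
    by (simp add: sampling_measure_def space_pair_measure space_PiM)
  have distr_D: "distr ?M ?D fst = ?D"
    unfolding sampling_measure_def by (rule T.distr_pair_fst)
  have fst_M [measurable]: "fst \<in> ?M \<rightarrow>\<^sub>M ?D"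
    unfolding sampling_measure_def by simp
  have test_M [measurable]: "(\<lambda>\<omega>. fst (snd \<omega>)) \<in> ?M \<rightarrow>\<^sub>M P"
    unfolding sampling_measure_def by measurable
  have "AE D in ?D. D i \<in> Z" for i
    using assms(5) by (intro D.AE_component) auto
  then have "AE D in distr ?M ?D fst. \<forall>i. D i \<in> Z"
    unfolding distr_D by (simp add: AE_all_countable)
  then have AE_D: "AE \<omega> in ?M. \<forall>i. fst \<omega> i \<in> Z"
    by (rule AE_distrD[OF fst_M])
  have AE_test: "AE \<omega> in ?M. fst (snd \<omega>) \<in> Z"
  proof -
    have "AE z in distr (P \<Otimes>\<^sub>M seed_measure) P fst. z \<in> Z"
      unfolding S.distr_pair_fst by fact
    then have "AE r in P \<Otimes>\<^sub>M seed_measure. fst r \<in> Z"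
      by (rule AE_distrD[OF measurable_fst])
    moreover have "{\<omega> \<in> space ?M. fst (snd \<omega>) \<in> Z} \<in> sets ?M"
    proof -
      have "Z \<in> sets P"
        unfolding assms(2) by (intro borel_closed finite_imp_closed assms)
      then show ?thesis using measurable_sets[OF test_M] by (simp add: vimage_def space)
    qed
    moreover have "pair_sigma_finite ?D (P \<Otimes>\<^sub>M seed_measure)" by unfold_locales
    ultimately show ?thesis
      unfolding sampling_measure_def by (intro pair_sigma_finite.AE_pair_measure) auto
  qed
  define E :: "nat \<Rightarrow> 'a outcome set" where "E n = {(D, (x, y), s). knn_classifier n (k n) D s x \<noteq> y}" for n
  define L where "L n = real_cond_exp ?M (training_algebra P n) (indicator (E n))" for n
  have E_sets [measurable]: "E n \<in> sets ?M" for n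
  proof -
    have "E n = {\<omega> \<in> space ?M. case \<omega> of (D, (x, y), s) \<Rightarrow> knn_classifier n (k n) D s x \<noteq> y}"
      by (auto simp: E_def space)
    then show ?thesis using knn_error_measurable[OF assms(2), of n "k n"] by simp
  qed
  define W where "W n z = {D \<in> space ?D. card {i. i < n \<and> D i = z} < k n}" for n z
  have single: "{z} \<in> sets P" for z
    unfolding assms(2) by (intro borel_closed) simp
  have W_sets: "W n z \<in> sets ?D" for n z
    unfolding W_def by (rule card_lt_set_measurable[OF single])
  have "(\<lambda>n. \<Sum>z\<in>Z. measure ?D (W n z)) \<longlonglongrightarrow> (\<Sum>z\<in>Z. 0)"
    unfolding W_def by (intro tendsto_sum prob_few_visits_tendsto_0 assms single pos)
  then have W_lim: "(\<lambda>n. \<Sum>z\<in>Z. measure ?D (W n z)) \<longlonglongrightarrow> 0" by simp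
  have E_le: "\<forall>\<^sub>F n in sequentially. measure ?M (E n) \<le> (\<Sum>z\<in>Z. measure ?D (W n z))"
  proof -
    \<comment> \<open>Divergence of \<open>k\<close> rules out an empty neighbourhood from some
      \<open>n\<close> on.\<close>
    have "\<forall>\<^sub>F n in sequentially. 0 < k n"
      using k(1)[unfolded filterlim_at_top, rule_format, of 1] by eventually_elim simp
    then show ?thesis
    proof eventually_elim
      case (elim n)
      \<comment> \<open>The union over all of \<open>Z\<close> replaces the random test atom by
        fixed ones, so that each event concerns the training sequence alone.\<close>
      have "measure ?M (E n) \<le> measure ?M (\<Union>z\<in>Z. fst -` W n z \<inter> space ?M)"
      proof (rule M.finite_measure_mono_AE)
        show "AE \<omega> in ?M. \<omega> \<in> E n \<longrightarrow> \<omega> \<in> (\<Union>z\<in>Z. fst -` W n z \<inter> space ?M)"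
          using AE_D AE_test
        proof eventually_elim
          case (elim \<omega>)
          obtain D z s where \<omega>: "\<omega> = (D, z, s)" by (cases \<omega>) auto
          have "D \<in> space ?D" using measurable_space[OF fst_M, of \<omega>] by (simp add: space \<omega>)
          moreover have "card {i. i < n \<and> D i = z} < k n" if "\<omega> \<in> E n"
          proof (rule ccontr)
            assume "\<not> card {i. i < n \<and> D i = z} < k n"
            then have "knn_classifier n (k n) D s (fst z) = snd z"
              using elim \<open>0 < k n\<close> \<omega> by (intro knn_classifier_atomic[OF assms(4)]) auto
            then show False using that by (auto simp: E_def \<omega>)
          qed
          ultimately show ?case using elim(2) by (auto simp: \<omega> W_def space)
        qed
        show "(\<Union>z\<in>Z. fst -` W n z \<inter> space ?M) \<in> M.events"
          using assms(3) measurable_sets[OF fst_M W_sets] by (intro sets.finite_UN) auto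
      qed
      also have "\<dots> \<le> (\<Sum>z\<in>Z. measure ?M (fst -` W n z \<inter> space ?M))"
        using assms(3) measurable_sets[OF fst_M W_sets]
        by (intro M.finite_measure_subadditive_finite) auto
      also have "\<dots> = (\<Sum>z\<in>Z. measure ?D (W n z))"
        using measure_distr[OF fst_M W_sets] by (simp add: distr_D)
      finally show ?case .
    qed
  qed
  have E_lim: "(\<lambda>n. measure ?M (E n)) \<longlonglongrightarrow> 0"
    by (rule tendsto_sandwich[OF _ E_le tendsto_const W_lim]) simp
  have L_tail: "measure ?M {\<omega> \<in> space ?M. \<bar>L n \<omega>\<bar> > e} \<le> measure ?M (E n) / e" if "e > 0" for n e
  proof -
    have "(\<lambda>\<omega>. restrict (fst \<omega>) {..<n}) \<in> ?M \<rightarrow>\<^sub>M (\<Pi>\<^sub>M i\<in>{..<n}. P)"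
      by (rule measurable_compose[OF fst_M measurable_restrict_subset]) simp
    then have "subalgebra ?M (training_algebra P n)"
      unfolding subalgebra_def training_algebra_def
      using sets_image_in_sets[OF refl] by (metis space_vimage_algebra)
    then interpret F: finite_measure_subalgebra ?M "training_algebra P n" by unfold_locales
    have int: "integrable ?M (indicator (E n) :: _ \<Rightarrow> real)"
      by (intro integrable_real_indicator E_sets) (simp add: M.emeasure_eq_measure)
    have [measurable]: "L n \<in> borel_measurable ?M" by (simp add: L_def)
    have AE: "AE \<omega> in ?M. 0 \<le> L n \<omega>"
      unfolding L_def by (intro F.real_cond_exp_pos) auto
    \<comment> \<open>The absolute value disappears only almost surely, because a version of the
      conditional probability is nonnegative only up to a null set.\<close>
    have "measure ?M {\<omega> \<in> space ?M. \<bar>L n \<omega>\<bar> > e} \<le> measure ?M {\<omega> \<in> space ?M. L n \<omega> \<ge> e}"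
    proof (rule M.finite_measure_mono_AE)
      show "AE \<omega> in ?M. \<omega> \<in> {\<omega> \<in> space ?M. \<bar>L n \<omega>\<bar> > e} \<longrightarrow> \<omega> \<in> {\<omega> \<in> space ?M. L n \<omega> \<ge> e}"
        using AE by eventually_elim auto
    qed measurable
    also have "\<dots> \<le> (\<integral>\<omega>. L n \<omega> \<partial>?M) / e"
      unfolding L_def using AE \<open>e > 0\<close>
      by (intro integral_Markov_inequality_measure[OF F.real_cond_exp_int(1)[OF int] sets.top])
        (auto simp: L_def)
    \<comment> \<open>Averaging the conditional error probability over the samples gives back the
      unconditional one.\<close>
    also have "(\<integral>\<omega>. L n \<omega> \<partial>?M) = measure ?M (E n)"
      unfolding L_def F.real_cond_exp_int(2)[OF int] by (simp add: space)
    finally show ?thesis .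
  qed
  have "(\<lambda>n. measure ?M {\<omega> \<in> space ?M. \<bar>L n \<omega>\<bar> > e}) \<longlonglongrightarrow> 0" if "e > 0" for e
  proof (rule tendsto_sandwich[OF _ _ tendsto_const])
    show "(\<lambda>n. measure ?M (E n) / e) \<longlonglongrightarrow> 0"
      using tendsto_divide[OF E_lim tendsto_const, of e] that by simp
  qed (use L_tail[OF that] in auto)
  moreover have "bayes_error P h = 0"
    using assms(5) h by (rule bayes_error_atomic)
  ultimately show ?thesis
    unfolding weakly_consistent_def tendsto_in_probability_def misclassification_prob_def
    by (simp add: L_def E_def)
qed

theorem proposition3:
  fixes Q :: "(usc \<times> bool) measure" and k :: "nat \<Rightarrow> nat"
  assumes "filterlim k at_top sequentially"
    and "(\<lambda>n. real (k n) / real n) \<longlonglongrightarrow> 0"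
    and "prob_space Q" and "sets Q = sets borel"
  shows "\<forall>N. openin weak_topology N \<and> Q \<in> N \<longrightarrow>
    (\<exists>P\<in>N. \<exists>\<eta> :: usc \<Rightarrow> real.
      continuous_on UNIV \<eta> \<and> range \<eta> \<subseteq> {0..1} \<and> compact (closure {x. \<eta> x \<noteq> 0}) \<and>
      regression_function P \<eta> \<and>
      weakly_consistent P \<eta> (\<lambda>n. knn_classifier n (k n)))"
proof (intro allI impI)
  fix N assume "openin weak_topology N \<and> Q \<in> N"
  then obtain P Z where P: "P \<in> N" "prob_space P" "sets P = sets borel" "finite Z" "inj_on fst Z"
    "AE z in P. z \<in> Z" "\<And>z. z \<in> Z \<Longrightarrow> measure P {z} > 0"
    using weak_nhd_contains_atomic[of N Q] assms(3,4) by metis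
  \<comment> \<open>The positions of the atoms labelled \<open>y\<close>. A position common to both
    labels would contradict injectivity of \<open>fst\<close> on \<open>Z\<close>, so the two sets
    can be separated.\<close>
  define A where "A y = fst ` {z \<in> Z. snd z = y}" for y
  have "A True \<inter> A False = {}"
    using inj_onD[OF P(5)] by (fastforce simp: A_def)
  moreover have "finite (A y)" for y using P(4) by (simp add: A_def)
  ultimately obtain \<eta> :: "usc \<Rightarrow> real" where \<eta>: "continuous_on UNIV \<eta>" "range \<eta> \<subseteq> {0..1}"
    "compact (closure {x. \<eta> x \<noteq> 0})" "\<And>x. x \<in> A True \<Longrightarrow> \<eta> x = 1" "\<And>x. x \<in> A False \<Longrightarrow> \<eta> x = 0"
    using finite_separating_function[of "A True" "A False"] by metis
  have lab: "\<eta> x = of_bool y" if "(x, y) \<in> Z" for x y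
  proof -
    have "x \<in> A y" using that by (force simp: A_def)
    then show ?thesis using \<eta>(4,5) by (cases y) auto
  qed
  have "regression_function P \<eta>"
    using P(2,3,6) borel_measurable_continuous_onI[OF \<eta>(1)] lab
    by (rule regression_function_atomic)
  moreover have "weakly_consistent P \<eta> (\<lambda>n. knn_classifier n (k n))"
    using P(2-7) lab assms(1,2) by (rule weakly_consistent_atomic)
  ultimately show "\<exists>P\<in>N. \<exists>\<eta> :: usc \<Rightarrow> real.
      continuous_on UNIV \<eta> \<and> range \<eta> \<subseteq> {0..1} \<and> compact (closure {x. \<eta> x \<noteq> 0}) \<and>
      regression_function P \<eta> \<and>
      weakly_consistent P \<eta> (\<lambda>n. knn_classifier n (k n))"
    using P(1) \<eta>(1-3) by blast
qed

end
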